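(* Let $p$ be a real number greater than one and let $G$ be a countably infinite, connected graph of bounded degree without self-loops. Assume that the $p$-harmonic boundary $\partial_p(G)$ of $G$ contains a finite number of points, say $\{x_1,x_2,\dots,x_n\}$. Then given real numbers $a_1,a_2,\dots,a_n$, there exists a bounded $p$-harmonic function $h$ on $G$ that satisfies $h(x_i)=a_i$ for $i=1,2,\dots,n$. Conversely, each bounded $p$-harmonic function is uniquely determined by its values $h(x_i)=a_i$, $i=1,2,\dots,n$.
   Context: Let $V$ be the vertex set of $G$, $N_x$ the set of neighbors of $x\in V$, and $o\in V$ a fixed vertex. Bounded degree means there is a positive integer $k$ with $\#N_x\le k$ for all $x$. For $f\colon V\to\mathbb{R}$ put $I_p(f,V)=\sum_{x\in V}\sum_{y\in N_x}|f(y)-f(x)|^p$ and $\Delta_p f(x)=\sum_{y\in N_x}|f(y)-f(x)|^{p-2}(f(y)-f(x))$, where a term is $0$ if $f(y)=f(x)$. A function $f\colon V\to\mathbb{R}$ is $p$-harmonic on $G$ if $\Delta_pf(x)=0$ for all $x\in V$. $D_p(G)=\{f\colon V\to\mathbb{R}\mid I_p(f,V)<\infty\}$ with norm $\|f\|_{D_p}=(I_p(f,V)+|f(o)|^p)^{1/p}$. $\ell^\infty(G)$ is the set of bounded real functions on $V$, and $BD_p(G)=D_p(G)\cap\ell^\infty(G)$, a commutative Banach algebra under pointwise multiplication with norm $\|f\|_{BD_p}=I_p(f,V)^{1/p}+\sup_V|f|$. $\mathbb{R}G$ is the set of finitely supported real functions on $V$, $(\overline{\mathbb{R}G})_{D_p}$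 is its closure in $D_p(G)$, and $B(\overline{\mathbb{R}G})_{D_p}=(\overline{\mathbb{R}G})_{D_p}\cap\ell^\infty(G)$. $Sp(BD_p(G))$ is the set of nonzero algebra homomorphisms $BD_p(G)\to\mathbb{C}$ with the weak-$*$ topology, a compact Hausdorff space. For $f\in BD_p(G)$, $\hat f(\tau)=\tau(f)$. $V$ is identified with its image in $Sp(BD_p(G))$ under $x\mapsto(f\mapsto f(x))$. The $p$-Royden boundary is $R_p(G)=Sp(BD_p(G))\setminus V$, and the $p$-harmonic boundary is $\partial_p(G)=\{x\in R_p(G)\mid \hat f(x)=0\text{ for all }f\in B(\overline{\mathbb{R}G})_{D_p}\}$. For a boundary point $x_i$, $h(x_i)=a_i$ is understood as $\lim_{k\to\infty}h(y_k)=a_i$ for any sequence $(y_k)$ in $V$ converging to $x_i$ in $Sp(BD_p(G))$.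
   Formalization: The value h(x_i)=a_i is taken along all nets (filters) in V converging to x_i, not only sequences, since in some graphs no sequence converges to x_i and uniqueness then fails; the p-harmonic boundary is assumed nonempty (n ≥ 1), as constants refute uniqueness otherwise. *)

theory Defs
  imports "HOL-Analysis.Analysis"
begin

(* The vertex set V is the whole type 'v; a graph is given by its adjacency relation. *)

definition nbrs :: "('v \<Rightarrow> 'v \<Rightarrow> bool) \<Rightarrow> 'v \<Rightarrow> 'v set" where
  "nbrs adj x = {y. adj x y}"

definition connected_graph :: "('v \<Rightarrow> 'v \<Rightarrow> bool) \<Rightarrow> bool" where
  "connected_graph adj \<longleftrightarrow> (\<forall>x y. adj\<^sup>*\<^sup>* x y)"

definition bounded_degree :: "('v \<Rightarrow> 'v \<Rightarrow> bool) \<Rightarrow> bool" where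
  "bounded_degree adj \<longleftrightarrow>
     (\<exists>k::nat. 0 < k \<and> (\<forall>x. finite (nbrs adj x) \<and> card (nbrs adj x) \<le> k))"

definition local_energy :: "('v \<Rightarrow> 'v \<Rightarrow> bool) \<Rightarrow> real \<Rightarrow> ('v \<Rightarrow> real) \<Rightarrow> 'v \<Rightarrow> real" where
  "local_energy adj p f x = (\<Sum>y\<in>nbrs adj x. \<bar>f y - f x\<bar> powr p)"

(* The p-Dirichlet sum over V. It is the intended value only if the sum converges; otherwise
   infsum is 0, so finiteness of the sum is expressed by summability in dirichlet_space. *)
definition dirichlet_sum :: "('v \<Rightarrow> 'v \<Rightarrow> bool) \<Rightarrow> real \<Rightarrow> ('v \<Rightarrow> real) \<Rightarrow> real" where
  "dirichlet_sum adj p f = infsum (local_energy adj p f) UNIV"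

definition dirichlet_space :: "('v \<Rightarrow> 'v \<Rightarrow> bool) \<Rightarrow> real \<Rightarrow> ('v \<Rightarrow> real) set" where
  "dirichlet_space adj p = {f. local_energy adj p f summable_on UNIV}"

definition dirichlet_norm ::
  "('v \<Rightarrow> 'v \<Rightarrow> bool) \<Rightarrow> real \<Rightarrow> 'v \<Rightarrow> ('v \<Rightarrow> real) \<Rightarrow> real" where
  "dirichlet_norm adj p v0 f = (dirichlet_sum adj p f + \<bar>f v0\<bar> powr p) powr (1 / p)"

(* A summand with f y = f x is 0, also when p < 2, because of its second factor. *)
definition p_laplacian ::
  "('v \<Rightarrow> 'v \<Rightarrow> bool) \<Rightarrow> real \<Rightarrow> ('v \<Rightarrow> real) \<Rightarrow> 'v \<Rightarrow> real" where
  "p_laplacian adj p f x = (\<Sum>y\<in>nbrs adj x. \<bar>f y - f x\<bar> powr (p - 2) * (f y - f x))"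

definition p_harmonic :: "('v \<Rightarrow> 'v \<Rightarrow> bool) \<Rightarrow> real \<Rightarrow> ('v \<Rightarrow> real) \<Rightarrow> bool" where
  "p_harmonic adj p f \<longleftrightarrow> (\<forall>x. p_laplacian adj p f x = 0)"

definition bounded_functions :: "('v \<Rightarrow> real) set" where
  "bounded_functions = {f. bounded (range f)}"

definition bounded_dirichlet :: "('v \<Rightarrow> 'v \<Rightarrow> bool) \<Rightarrow> real \<Rightarrow> ('v \<Rightarrow> real) set" where
  "bounded_dirichlet adj p = dirichlet_space adj p \<inter> bounded_functions"

definition finitely_supported :: "('v \<Rightarrow> real) set" where
  "finitely_supported = {f. finite {x. f x \<noteq> 0}}"

definition dirichlet_closure ::
  "('v \<Rightarrow> 'v \<Rightarrow> bool) \<Rightarrow> real \<Rightarrow> 'v \<Rightarrow> ('v \<Rightarrow> real) set" where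
  "dirichlet_closure adj p v0 =
     {f \<in> dirichlet_space adj p.
        \<forall>e>0. \<exists>g\<in>finitely_supported. dirichlet_norm adj p v0 (\<lambda>x. f x - g x) < e}"

(* Nonzero homomorphisms of real algebras from BD_p to the complex numbers. A functional on BD_p
   is a HOL function that is undefined outside BD_p, so that equality is equality on BD_p. *)
definition spectrum ::
  "('v \<Rightarrow> 'v \<Rightarrow> bool) \<Rightarrow> real \<Rightarrow> (('v \<Rightarrow> real) \<Rightarrow> complex) set" where
  "spectrum adj p =
     {\<tau> \<in> extensional (bounded_dirichlet adj p).
        (\<forall>f\<in>bounded_dirichlet adj p. \<forall>g\<in>bounded_dirichlet adj p.
           \<tau> (\<lambda>x. f x + g x) = \<tau> f + \<tau> g \<and> \<tau> (\<lambda>x. f x * g x) = \<tau> f * \<tau> g) \<and>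
        (\<forall>c. \<forall>f\<in>bounded_dirichlet adj p. \<tau> (\<lambda>x. c * f x) = complex_of_real c * \<tau> f) \<and>
        (\<exists>f\<in>bounded_dirichlet adj p. \<tau> f \<noteq> 0)}"

(* The weak-* topology is the topology of pointwise convergence on BD_p. *)
definition spectrum_topology ::
  "('v \<Rightarrow> 'v \<Rightarrow> bool) \<Rightarrow> real \<Rightarrow> (('v \<Rightarrow> real) \<Rightarrow> complex) topology" where
  "spectrum_topology adj p =
     subtopology (product_topology (\<lambda>_. euclidean) (bounded_dirichlet adj p)) (spectrum adj p)"

definition point_eval ::
  "('v \<Rightarrow> 'v \<Rightarrow> bool) \<Rightarrow> real \<Rightarrow> 'v \<Rightarrow> ('v \<Rightarrow> real) \<Rightarrow> complex" where
  "point_eval adj p x = restrict (\<lambda>f. complex_of_real (f x)) (bounded_dirichlet adj p)"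

definition royden_boundary ::
  "('v \<Rightarrow> 'v \<Rightarrow> bool) \<Rightarrow> real \<Rightarrow> (('v \<Rightarrow> real) \<Rightarrow> complex) set" where
  "royden_boundary adj p = spectrum adj p - range (point_eval adj p)"

definition harmonic_boundary ::
  "('v \<Rightarrow> 'v \<Rightarrow> bool) \<Rightarrow> real \<Rightarrow> 'v \<Rightarrow> (('v \<Rightarrow> real) \<Rightarrow> complex) set" where
  "harmonic_boundary adj p v0 =
     {\<tau> \<in> royden_boundary adj p.
        \<forall>f \<in> dirichlet_closure adj p v0 \<inter> bounded_functions. \<tau> f = 0}"

(* "h(\<tau>) = a" at a boundary point: h tends to a along everything in V that converges to \<tau>.
   The spectrum need not be first countable, and there are graphs for which no sequence in V
   converges to a point of the harmonic boundary, so convergence is taken along arbitrary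
   filters on V (equivalently, nets) rather than along sequences alone. *)
definition has_boundary_value ::
  "('v \<Rightarrow> 'v \<Rightarrow> bool) \<Rightarrow> real \<Rightarrow> ('v \<Rightarrow> real) \<Rightarrow> (('v \<Rightarrow> real) \<Rightarrow> complex) \<Rightarrow> real \<Rightarrow> bool" where
  "has_boundary_value adj p h \<tau> a \<longleftrightarrow>
     (\<forall>F. limitin (spectrum_topology adj p) (point_eval adj p) \<tau> F \<longrightarrow> (h \<longlongrightarrow> a) F)"

lemma has_boundary_value_sequentially:
  assumes "has_boundary_value adj p h \<tau> a"
    and "limitin (spectrum_topology adj p) (\<lambda>k::nat. point_eval adj p (y k)) \<tau> sequentially"
  shows "(\<lambda>k. h (y k)) \<longlonglongrightarrow> a"
proof -
  have "limitin (spectrum_topology adj p) (point_eval adj p) \<tau> (filtermap y sequentially)"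
    using assms(2) by (simp add: limitin_def eventually_filtermap)
  then have "(h \<longlongrightarrow> a) (filtermap y sequentially)"
    using assms(1) unfolding has_boundary_value_def by blast
  then show ?thesis
    by (simp add: filterlim_filtermap)
qed

end

theory Submission
  imports Defs
begin

text \<open>
  Boundary values are attained along filters converging in the spectrum, and every function in
  the algebra \<open>BD\<close> of bounded functions of finite energy extends continuously to the spectrum. The
  idea is to replace boundary data by a class
  \<open>f + C0\<close>, where \<open>f \<in> BD\<close> has the prescribed boundary values and \<open>C0\<close> is the closure of the
  finitely supported functions. Elements of \<open>C0 \<inter> \<ell>\<^sup>\<infinity>\<close> vanish on the harmonic boundary by its very
  definition, so all bounded members of the class have the same boundary values, and the class is
  the right domain for a variational problem.

  The analytic core is one obstacle problem (\<open>p_harmonic_between_obstacles\<close>): if \<open>l \<le> f \<le> u\<close> with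
  \<open>l\<close> subharmonic and \<open>u\<close> superharmonic, both possibly of infinite energy, then the minimiser of the
  energy over \<open>{w \<in> f + C0. l \<le> w \<le> u}\<close> is p-harmonic. Away from the obstacles this is the
  Euler-Lagrange equation; where \<open>w\<close> touches an obstacle, comparing \<open>w\<close> with it at the contact vertex
  gives the missing inequality. Minimising sequences converge strongly because \<open>\<bar>t\<bar> powr p\<close> is
  uniformly convex. With constant obstacles this solves the Dirichlet problem by a bounded function.
  Interpolation of finitely many values by some \<open>f \<in> BD\<close> is algebra: homomorphisms
  are real valued because \<open>BD\<close> is closed under inverses of functions bounded away from 0, and
  distinct homomorphisms are separated by elements of \<open>BD\<close>.

  Uniqueness has to deal with bounded p-harmonic functions \<open>h\<close> that need not have finite energy, so
  energy methods do not apply to \<open>h\<close> itself. However, if \<open>h\<close> has the boundary values of \<open>f\<close>, then for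
  \<open>e > 0\<close> the set \<open>{h > f + e}\<close> stays away from the harmonic boundary, and a compactness argument
  yields a bounded \<open>g \<in> C0\<close> with \<open>\<bar>g\<bar> \<ge> 1\<close> on it (\<open>excess_set_dominated_by_closure\<close>). Hence
  \<open>h - e \<le> f + M * \<bar>g\<bar>\<close> for a suitable constant \<open>M\<close>, and the obstacle problem with lower obstacle
  \<open>h - e\<close> produces a p-harmonic \<open>w \<in> f + C0\<close> of finite energy with \<open>h \<le> w + e\<close>
  (\<open>p_harmonic_majorant\<close>). The class \<open>f + C0\<close> contains only one p-harmonic function: any two of them
  minimise the energy in it, so by uniform convexity they differ by a constant, and a nonzero
  constant in \<open>C0\<close> would force the harmonic boundary to be empty. Thus \<open>w\<close> does not depend on \<open>h\<close>, and
  applying this to \<open>h1\<close> and to \<open>- h2\<close> squeezes \<open>h1 \<le> h2 + 2 * e\<close>.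
\<close>

section \<open>Convexity of the p-th power\<close>

text \<open>For \<open>p > 1\<close> this is \<open>1 / p\<close> times the derivative of \<open>\<bar>t\<bar> powr p\<close>; the p-Laplacian sums it over increments.\<close>

definition signed_powr :: "real \<Rightarrow> real \<Rightarrow> real" where
  "signed_powr p t = \<bar>t\<bar> powr (p - 2) * t"

lemma signed_powr_eq: "signed_powr p t = sgn t * \<bar>t\<bar> powr (p - 1)"
proof (cases "t = 0")
  case False
  have "\<bar>t\<bar> powr (p - 1) = \<bar>t\<bar> powr (p - 2) * \<bar>t\<bar>"
    using powr_mult_base[of "\<bar>t\<bar>" "p - 2"] by (simp add: mult.commute)
  then show ?thesis by (simp add: signed_powr_def sgn_if)
qed (simp add: signed_powr_def)

lemma signed_powr_strict_mono:
  assumes p: "1 < p" and "a < b"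
  shows "signed_powr p a < signed_powr p b"
proof -
  consider "0 \<le> a" | "b \<le> 0" | "a < 0" "0 < b" by linarith
  then show ?thesis
  proof cases
    case 1
    then have "a powr (p - 1) < b powr (p - 1)"
      using p \<open>a < b\<close> by (intro powr_less_mono2) auto
    then show ?thesis using 1 \<open>a < b\<close> by (auto simp: signed_powr_eq sgn_if)
  next
    case 2
    then have "\<bar>b\<bar> powr (p - 1) < \<bar>a\<bar> powr (p - 1)"
      using p \<open>a < b\<close> by (intro powr_less_mono2) auto
    then show ?thesis using 2 \<open>a < b\<close> by (auto simp: signed_powr_eq sgn_if)
  next
    case 3
    then show ?thesis by (auto simp: signed_powr_eq sgn_if intro: order_less_trans[of _ 0])
  qed
qed

lemma signed_powr_mono: "1 < p \<Longrightarrow> a \<le> b \<Longrightarrow> signed_powr p a \<le> signed_powr p b"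
  using signed_powr_strict_mono[of p a b] by (cases "a = b") auto

lemma signed_powr_minus: "signed_powr p (- t) = - signed_powr p t"
  by (simp add: signed_powr_def)

lemma continuous_signed_powr:
  assumes p: "1 < p"
  shows "isCont (signed_powr p) t"
proof (cases "t = 0")
  case False
  then show ?thesis unfolding signed_powr_def
    by (intro continuous_intros) auto
next
  case True
  have "((\<lambda>t. \<bar>t\<bar> powr (p - 1)) \<longlongrightarrow> 0) (at (0::real))"
    by (rule tendsto_eq_intros tendsto_zero_powrI | use p in auto)+
  then have "((\<lambda>t. signed_powr p t) \<longlongrightarrow> 0) (at 0)"
    by (rule Lim_null_comparison[rotated])
       (auto simp: signed_powr_eq sgn_if intro!: always_eventually)
  moreover have "signed_powr p 0 = 0" by (simp add: signed_powr_def)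
  ultimately show ?thesis using True by (simp add: isCont_def)
qed

text \<open>Young's inequality for \<open>signed_powr p a * b\<close> with the conjugate exponents \<open>p / (p - 1)\<close> and
  \<open>p\<close>.\<close>

lemma abs_powr_ge_tangent:
  fixes a b p :: real
  assumes p: "1 < p"
  shows "\<bar>a\<bar> powr p + p * signed_powr p a * (b - a) \<le> \<bar>b\<bar> powr p"
proof -
  define q where "q = p / (p - 1)"
  have q: "1 < q" "1 / q + 1 / p = 1" using p by (auto simp: q_def field_simps)
  have pw: "(\<bar>a\<bar> powr (p - 1)) powr q = \<bar>a\<bar> powr p"
    using p by (simp add: powr_powr q_def)
  have aa: "signed_powr p a * a = \<bar>a\<bar> powr p"
  proof (cases "a = 0")
    case False
    then have "\<bar>a\<bar> powr p = \<bar>a\<bar> * \<bar>a\<bar> powr (p - 1)"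
      using powr_mult_base[of "\<bar>a\<bar>" "p - 1"] by simp
    then show ?thesis using False by (simp add: signed_powr_eq sgn_if)
  qed (simp add: signed_powr_def)
  have "signed_powr p a * b \<le> \<bar>signed_powr p a * b\<bar>" by simp
  also have "\<dots> \<le> \<bar>a\<bar> powr (p - 1) * \<bar>b\<bar>"
    by (auto simp: signed_powr_eq abs_mult sgn_if)
  also have "\<dots> \<le> (\<bar>a\<bar> powr (p - 1)) powr q / q + \<bar>b\<bar> powr p / p"
    using q p by (intro Youngs_inequality) auto
  also have "\<dots> = \<bar>a\<bar> powr p * (p - 1) / p + \<bar>b\<bar> powr p / p"
    unfolding pw using p by (simp add: q_def field_simps)
  finally have "p * (signed_powr p a * b) \<le> \<bar>a\<bar> powr p * (p - 1) + \<bar>b\<bar> powr p"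
    using p by (simp add: field_simps)
  then show ?thesis using aa by (simp add: algebra_simps)
qed

text \<open>Strictness comes from passing through the midpoint: the slope there differs from the slope at
  \<open>a\<close> by strict monotonicity.\<close>

lemma abs_powr_gt_tangent:
  fixes a b p :: real
  assumes p: "1 < p" and "a \<noteq> b"
  shows "\<bar>a\<bar> powr p + p * signed_powr p a * (b - a) < \<bar>b\<bar> powr p"
proof -
  define d where "d = (a + b) / 2"
  have 1: "\<bar>d\<bar> powr p + p * signed_powr p d * (b - d) \<le> \<bar>b\<bar> powr p"
    and 2: "\<bar>a\<bar> powr p + p * signed_powr p a * (d - a) \<le> \<bar>d\<bar> powr p"
    using abs_powr_ge_tangent[OF p] by auto
  have 3: "b - a = (b - d) + (d - a)" "b - d = d - a" by (auto simp: d_def field_simps)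
  have "0 < (signed_powr p d - signed_powr p a) * (d - a)"
    using signed_powr_strict_mono[OF p, of a d] signed_powr_strict_mono[OF p, of d a] \<open>a \<noteq> b\<close>
    by (cases "a < b") (auto simp: zero_less_mult_iff d_def)
  then have "0 < p * ((signed_powr p d - signed_powr p a) * (d - a))" using p by simp
  then have "p * signed_powr p a * (d - a) < p * signed_powr p d * (d - a)"
    by (simp add: algebra_simps)
  moreover have "p * signed_powr p a * (b - a) = 2 * (p * signed_powr p a * (d - a))"
    unfolding 3 by (simp add: algebra_simps)
  ultimately show ?thesis using 1 2 unfolding 3(2) by linarith
qed

lemma abs_powr_midpoint_less:
  fixes a b p :: real
  assumes "1 < p" "a \<noteq> b"
  shows "\<bar>(a + b) / 2\<bar> powr p < (\<bar>a\<bar> powr p + \<bar>b\<bar> powr p) / 2"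
proof -
  define d where "d = (a + b) / 2"
  define k where "k = p * signed_powr p d * (b - d)"
  have "d \<noteq> a" "d \<noteq> b" and opp: "a - d = - (b - d)"
    using assms by (auto simp: d_def field_simps)
  have "\<bar>d\<bar> powr p + k < \<bar>b\<bar> powr p"
    unfolding k_def by (rule abs_powr_gt_tangent[OF assms(1) \<open>d \<noteq> b\<close>])
  moreover have "\<bar>d\<bar> powr p + p * signed_powr p d * (a - d) < \<bar>a\<bar> powr p"
    by (rule abs_powr_gt_tangent[OF assms(1) \<open>d \<noteq> a\<close>])
  moreover have "p * signed_powr p d * (a - d) = - k"
    by (simp only: opp k_def mult_minus_right)
  moreover have "X < (A + B) / 2" if "X + k < B" "X + l < A" "l = - k" for X A B l
    using that by simp
  ultimately show ?thesis unfolding d_def[symmetric] by blast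
qed

text \<open>Convexity of \<open>\<bar>t\<bar> powr p\<close> at the convex combination \<open>\<mu> * (a / \<mu>) + (1 - \<mu>) * (b / (1 - \<mu>))\<close>.
  The free weight lets the coefficient of \<open>\<bar>a\<bar> powr p\<close> come arbitrarily close to 1.\<close>

lemma abs_powr_convex:
  fixes a b p \<mu> :: real
  assumes p: "1 < p" and "0 < \<mu>" "\<mu> < 1"
  shows "\<bar>a + b\<bar> powr p \<le> \<mu> powr (1 - p) * \<bar>a\<bar> powr p + (1 - \<mu>) powr (1 - p) * \<bar>b\<bar> powr p"
proof -
  define s t c where "s = a / \<mu>" and "t = b / (1 - \<mu>)" and "c = a + b"
  have c: "c = \<mu> * s + (1 - \<mu>) * t" using assms by (simp add: s_def t_def c_def)
  have "\<mu> * (\<bar>c\<bar> powr p + p * signed_powr p c * (s - c)) \<le> \<mu> * \<bar>s\<bar> powr p"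
       "(1 - \<mu>) * (\<bar>c\<bar> powr p + p * signed_powr p c * (t - c)) \<le> (1 - \<mu>) * \<bar>t\<bar> powr p"
    using assms by (auto intro!: mult_left_mono abs_powr_ge_tangent)
  moreover have "\<mu> * (\<bar>c\<bar> powr p + p * signed_powr p c * (s - c))
      + (1 - \<mu>) * (\<bar>c\<bar> powr p + p * signed_powr p c * (t - c))
    = \<bar>c\<bar> powr p + p * signed_powr p c * (\<mu> * s + (1 - \<mu>) * t - c)"
    by (simp add: algebra_simps)
  ultimately have "\<bar>c\<bar> powr p \<le> \<mu> * \<bar>s\<bar> powr p + (1 - \<mu>) * \<bar>t\<bar> powr p"
    using c by simp
  moreover have "m * \<bar>z / m\<bar> powr p = m powr (1 - p) * \<bar>z\<bar> powr p" if "0 < m" for m z :: real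
    using that by (simp add: abs_divide powr_divide powr_diff)
  ultimately show ?thesis using assms by (simp add: s_def t_def c_def)
qed

lemma abs_powr_add_le:
  fixes a b p :: real
  assumes "1 < p"
  shows "\<bar>a + b\<bar> powr p \<le> 2 powr p * \<bar>a\<bar> powr p + 2 powr p * \<bar>b\<bar> powr p"
proof -
  have "(1/2::real) powr (1 - p) \<le> 2 powr p"
    using assms by (simp add: powr_divide powr_diff)
  then have "(1/2) powr (1 - p) * x \<le> 2 powr p * x" if "0 \<le> x" for x :: real
    using that by (rule mult_right_mono)
  from add_mono[OF this[of "\<bar>a\<bar> powr p"] this[of "\<bar>b\<bar> powr p"]]
  show ?thesis using abs_powr_convex[OF assms, of "1/2" a b] by simp
qed

lemma abs_powr_add_le_eps:
  fixes p e :: real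
  assumes p: "1 < p" and "0 < e"
  obtains C where "0 \<le> C" "\<And>a b. \<bar>a + b\<bar> powr p \<le> (1 + e) * \<bar>a\<bar> powr p + C * \<bar>b\<bar> powr p"
proof -
  \<comment> \<open>the weight for which \<open>\<mu> powr (1 - p) = 1 + e\<close>\<close>
  define \<mu> where "\<mu> = (1 + e) powr (- 1 / (p - 1))"
  have "0 < \<mu>" "\<mu> < 1" using assms by (auto simp: \<mu>_def powr_less_one)
  moreover have "- 1 / (p - 1) * (1 - p) = 1" using p by (simp add: divide_simps)
  then have "\<mu> powr (1 - p) = 1 + e"
    using assms by (simp add: \<mu>_def powr_powr)
  ultimately show ?thesis
    using that[of "(1 - \<mu>) powr (1 - p)"] abs_powr_convex[OF p, of \<mu>] by simp
qed

lemma continuous_on_abs_powr: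
  fixes f :: "'a::topological_space \<Rightarrow> real"
  assumes "1 < p" "continuous_on S f"
  shows "continuous_on S (\<lambda>z. \<bar>f z\<bar> powr p)"
  using assms by (intro continuous_on_powr' continuous_intros) auto

text \<open>A form of uniform convexity that serves all \<open>p > 1\<close> at once and can be summed over edges, in
  place of Clarkson's inequalities. By homogeneity it suffices to consider pairs with maximum norm 1.
  There either \<open>\<bar>a - b\<bar> powr p \<le> e * (\<bar>a\<bar> powr p + \<bar>b\<bar> powr p)\<close>, or the pair lies in a compact set that
  avoids the diagonal, on which the midpoint gap is bounded below.\<close>

lemma abs_powr_uniformly_convex:
  fixes p e :: real
  assumes p: "1 < p" and e: "0 < e"
  obtains C where "0 \<le> C"
    "\<And>a b. \<bar>a - b\<bar> powr p + C * \<bar>(a + b) / 2\<bar> powr p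
            \<le> (e + C / 2) * (\<bar>a\<bar> powr p + \<bar>b\<bar> powr p)"
proof -
  define gap where "gap = (\<lambda>z::real \<times> real. (\<bar>fst z\<bar> powr p + \<bar>snd z\<bar> powr p) / 2
      - \<bar>(fst z + snd z) / 2\<bar> powr p)"
  define Q where "Q = (cball 0 1 \<times> cball 0 1)
     \<inter> {z::real \<times> real. e * (\<bar>fst z\<bar> powr p + \<bar>snd z\<bar> powr p) \<le> \<bar>fst z - snd z\<bar> powr p}
     \<inter> {z. 1 \<le> \<bar>fst z\<bar> powr p + \<bar>snd z\<bar> powr p}"
  have "compact Q" unfolding Q_def
    by (intro compact_Int_closed compact_Times compact_cball closed_Collect_le
        continuous_intros continuous_on_abs_powr p)
  have "continuous_on Q (\<lambda>z. \<bar>fst z\<bar> powr p)" "continuous_on Q (\<lambda>z. \<bar>snd z\<bar> powr p)"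
    "continuous_on Q (\<lambda>z. \<bar>(fst z + snd z) / 2\<bar> powr p)"
    by (intro continuous_on_abs_powr p continuous_intros; simp)+
  then have cont: "continuous_on Q gap"
    unfolding gap_def by (intro continuous_on_diff continuous_on_divide continuous_on_add continuous_on_const) auto
  have pos: "0 < gap z" if "z \<in> Q" for z
  proof -
    have "fst z \<noteq> snd z"
    proof
      assume "fst z = snd z"
      then have "e * (\<bar>fst z\<bar> powr p + \<bar>snd z\<bar> powr p) \<le> 0" using that p by (simp add: Q_def)
      moreover have "0 < e * (\<bar>fst z\<bar> powr p + \<bar>snd z\<bar> powr p)"
        using that e by (intro mult_pos_pos) (auto simp: Q_def)
      ultimately show False by simp
    qed
    then show ?thesis using abs_powr_midpoint_less[OF p] by (simp add: gap_def)
  qed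
  obtain c where c: "0 < c" "\<And>z. z \<in> Q \<Longrightarrow> c \<le> gap z"
  proof (cases "Q = {}")
    case False
    then obtain z where "z \<in> Q" "\<forall>y\<in>Q. gap z \<le> gap y"
      using continuous_attains_inf[OF \<open>compact Q\<close> _ cont] by blast
    then show ?thesis using pos that by blast
  qed (use that[of 1] in auto)
  define C where "C = 2 powr p / c"
  have C: "0 \<le> C" using c by (simp add: C_def)
  have unit: "\<bar>a - b\<bar> powr p \<le> e * (\<bar>a\<bar> powr p + \<bar>b\<bar> powr p) + C * gap (a, b)"
    if "\<bar>a\<bar> \<le> 1" "\<bar>b\<bar> \<le> 1" "\<bar>a\<bar> = 1 \<or> \<bar>b\<bar> = 1" for a b
  proof (cases "e * (\<bar>a\<bar> powr p + \<bar>b\<bar> powr p) \<le> \<bar>a - b\<bar> powr p")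
    case True
    have "1 \<le> \<bar>a\<bar> powr p + \<bar>b\<bar> powr p" using that(3) by auto
    then have "(a, b) \<in> Q" using that True by (auto simp: Q_def)
    then have "2 powr p \<le> C * gap (a, b)"
      using c mult_left_mono[of c "gap (a, b)" C] C by (auto simp: C_def)
    moreover have "\<bar>a - b\<bar> powr p \<le> 2 powr p" using that p by (intro powr_mono2) auto
    moreover have "0 \<le> e * (\<bar>a\<bar> powr p + \<bar>b\<bar> powr p)" using e by simp
    ultimately show ?thesis by linarith
  next
    case False
    have "0 \<le> gap (a, b)"
      using abs_powr_midpoint_less[OF p, of a b] by (cases "a = b") (auto simp: gap_def simp del: abs_divide)
    then show ?thesis using False C by (smt (verit) mult_nonneg_nonneg)
  qed
  have "\<bar>a - b\<bar> powr p + C * \<bar>(a + b) / 2\<bar> powr p \<le> (e + C / 2) * (\<bar>a\<bar> powr p + \<bar>b\<bar> powr p)"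
    for a b
  proof (cases "a = 0 \<and> b = 0")
    case False
    define r where "r = max \<bar>a\<bar> \<bar>b\<bar>"
    have r: "0 < r" using False by (auto simp: r_def)
    have scale: "\<bar>r * t\<bar> powr p = r powr p * \<bar>t\<bar> powr p" for t
      using r by (simp add: abs_mult powr_mult)
    define a' b' where "a' = a / r" and "b' = b / r"
    have ab: "a = r * a'" "b = r * b'" using r by (auto simp: a'_def b'_def)
    have u: "\<bar>a' - b'\<bar> powr p \<le> e * (\<bar>a'\<bar> powr p + \<bar>b'\<bar> powr p) + C * gap (a', b')"
      using r by (intro unit) (auto simp: a'_def b'_def r_def)
    have *: "\<bar>a' - b'\<bar> powr p + C * \<bar>(a' + b') / 2\<bar> powr p \<le> (e + C / 2) * (\<bar>a'\<bar> powr p + \<bar>b'\<bar> powr p)"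
      using u by (simp add: gap_def field_simps)
    have "\<bar>a - b\<bar> powr p = r powr p * \<bar>a' - b'\<bar> powr p"
      "\<bar>(a + b) / 2\<bar> powr p = r powr p * \<bar>(a' + b') / 2\<bar> powr p"
      "\<bar>a\<bar> powr p = r powr p * \<bar>a'\<bar> powr p" "\<bar>b\<bar> powr p = r powr p * \<bar>b'\<bar> powr p"
      using scale[of "a' - b'"] scale[of "(a' + b') / 2"] scale[of a'] scale[of b']
      by (simp_all only: ab right_diff_distrib distrib_left times_divide_eq_right)
    then show ?thesis
      using mult_left_mono[OF *, of "r powr p"] by (simp add: algebra_simps del: abs_divide)
  qed (use p in simp)
  then show ?thesis using C that by blast
qed

section \<open>The Dirichlet energy\<close>

text \<open>In this locale, \<open>E\<close> is the energy at a vertex, \<open>I\<close> the total energy, \<open>D\<close> the functions of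
  finite energy, \<open>C0\<close> the closure in \<open>D\<close> of the finitely supported functions, \<open>BD\<close> the algebra of
  bounded functions in \<open>D\<close>, and \<open>L\<close> the p-Laplacian.\<close>

locale dirichlet_graph =
  fixes adj :: "'v \<Rightarrow> 'v \<Rightarrow> bool" and p :: real and v0 :: 'v
  assumes p: "1 < p"
    and adj_sym: "adj x y \<Longrightarrow> adj y x"
    and no_loop: "\<not> adj x x"
    and connected: "adj\<^sup>*\<^sup>* x y"
    and finite_nbrs: "finite (nbrs adj x)"
begin

abbreviation "E \<equiv> local_energy adj p"
abbreviation "I \<equiv> dirichlet_sum adj p"
abbreviation "D \<equiv> dirichlet_space adj p"
abbreviation "C0 \<equiv> dirichlet_closure adj p v0"
abbreviation "BD \<equiv> bounded_dirichlet adj p"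
abbreviation "L \<equiv> p_laplacian adj p"

lemma local_energy_nonneg: "0 \<le> E f x"
  unfolding local_energy_def by (intro sum_nonneg) simp

lemma dirichlet_sum_nonneg: "0 \<le> I f"
  unfolding dirichlet_sum_def by (intro infsum_nonneg local_energy_nonneg)

lemma sum_local_energy_le:
  assumes "f \<in> D" "finite S"
  shows "sum (E f) S \<le> I f"
  unfolding dirichlet_sum_def
  using assms by (intro finite_sum_le_infsum) (auto simp: dirichlet_space_def local_energy_nonneg)

lemma dirichlet_sum_leI:
  assumes "\<And>S. finite S \<Longrightarrow> sum (E f) S \<le> c"
  shows "f \<in> D" "I f \<le> c"
proof -
  have "E f summable_on UNIV"
    using assms by (intro nonneg_bdd_above_summable_on) (auto simp: local_energy_nonneg intro!: bdd_aboveI)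
  then show "f \<in> D" "I f \<le> c"
    using assms by (auto simp: dirichlet_space_def dirichlet_sum_def intro!: infsum_le_finite_sums)
qed

lemma edge_le_dirichlet_sum:
  assumes "f \<in> D" "adj x y"
  shows "\<bar>f y - f x\<bar> powr p \<le> I f"
proof -
  have "\<bar>f y - f x\<bar> powr p \<le> E f x"
    unfolding local_energy_def using assms finite_nbrs[of x]
    by (intro member_le_sum[of y "nbrs adj x" "\<lambda>y. \<bar>f y - f x\<bar> powr p"]) (auto simp: nbrs_def)
  also have "\<dots> \<le> I f" using sum_local_energy_le[OF assms(1), of "{x}"] by simp
  finally show ?thesis .
qed

lemma local_energy_le_combination:
  assumes "\<And>x y. \<bar>f y - f x\<bar> powr p \<le> a * \<bar>g y - g x\<bar> powr p + b * \<bar>k y - k x\<bar> powr p"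
  shows "E f x \<le> a * E g x + b * E k x"
  unfolding local_energy_def sum_distrib_left sum.distrib[symmetric]
  by (intro sum_mono assms)

text \<open>Every bound on energies below is an inequality between increments along a single edge, summed
  over all edges by this lemma.\<close>

lemma dirichlet_sum_le_combination:
  assumes "\<And>x y. \<bar>f y - f x\<bar> powr p \<le> a * \<bar>g y - g x\<bar> powr p + b * \<bar>k y - k x\<bar> powr p"
    and "0 \<le> a" "0 \<le> b" "g \<in> D" "k \<in> D"
  shows "f \<in> D" "I f \<le> a * I g + b * I k"
proof -
  have "sum (E f) S \<le> a * I g + b * I k" if S: "finite S" for S
  proof -
    have "sum (E f) S \<le> (\<Sum>x\<in>S. a * E g x + b * E k x)"
      by (intro sum_mono local_energy_le_combination assms)
    also have "\<dots> = a * sum (E g) S + b * sum (E k) S"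
      by (simp add: sum.distrib sum_distrib_left)
    also have "\<dots> \<le> a * I g + b * I k"
      using assms S by (intro add_mono mult_left_mono sum_local_energy_le)
    finally show ?thesis .
  qed
  then show "f \<in> D" "I f \<le> a * I g + b * I k" by (auto intro: dirichlet_sum_leI)
qed

text \<open>All closure properties of \<open>D\<close> (sums, products, inverses, contractions) follow from such
  Lipschitz-type bounds on increments.\<close>

lemma dirichlet_space_if_increments_le:
  assumes le: "\<And>x y. \<bar>f y - f x\<bar> \<le> a * \<bar>g y - g x\<bar> + b * \<bar>k y - k x\<bar>"
    and "0 \<le> a" "0 \<le> b" "g \<in> D" "k \<in> D"
  shows "f \<in> D"
proof (rule dirichlet_sum_le_combination(1)[where a = "2 powr p * a powr p" and b = "2 powr p * b powr p"])
  fix x y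
  have "\<bar>f y - f x\<bar> powr p \<le> \<bar>a * \<bar>g y - g x\<bar> + b * \<bar>k y - k x\<bar>\<bar> powr p"
    using p le[of y x] by (intro powr_mono2) auto
  also have "\<dots> \<le> 2 powr p * \<bar>a * \<bar>g y - g x\<bar>\<bar> powr p + 2 powr p * \<bar>b * \<bar>k y - k x\<bar>\<bar> powr p"
    by (rule abs_powr_add_le[OF p])
  also have "\<dots> = 2 powr p * a powr p * \<bar>g y - g x\<bar> powr p + 2 powr p * b powr p * \<bar>k y - k x\<bar> powr p"
    using assms by (simp add: abs_mult powr_mult)
  finally show "\<bar>f y - f x\<bar> powr p \<le> \<dots>" .
qed (use assms in auto)

lemma const_in_dirichlet_space: "(\<lambda>_. c) \<in> D"
  by (rule dirichlet_sum_leI[where c = 0]) (simp add: local_energy_def)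

lemma dirichlet_space_add: "f \<in> D \<Longrightarrow> g \<in> D \<Longrightarrow> (\<lambda>x. f x + g x) \<in> D"
  by (rule dirichlet_space_if_increments_le[where g = f and k = g and a = 1 and b = 1]) auto

lemma dirichlet_space_cmult: "f \<in> D \<Longrightarrow> (\<lambda>x. c * f x) \<in> D"
  by (rule dirichlet_space_if_increments_le[where g = f and k = f and a = "\<bar>c\<bar>" and b = 0])
     (auto simp: abs_mult[symmetric] right_diff_distrib)

lemma dirichlet_space_diff: "f \<in> D \<Longrightarrow> g \<in> D \<Longrightarrow> (\<lambda>x. f x - g x) \<in> D"
  by (rule dirichlet_space_if_increments_le[where g = f and k = g and a = 1 and b = 1]) auto

lemma dirichlet_sum_add_le:
  assumes "f \<in> D" "g \<in> D"
  shows "I (\<lambda>x. f x + g x) \<le> 2 powr p * I f + 2 powr p * I g"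
proof (rule dirichlet_sum_le_combination(2))
  fix x y show "\<bar>f y + g y - (f x + g x)\<bar> powr p
      \<le> 2 powr p * \<bar>f y - f x\<bar> powr p + 2 powr p * \<bar>g y - g x\<bar> powr p"
    using abs_powr_add_le[OF p, of "f y - f x" "g y - g x"] by (simp add: algebra_simps)
qed (use assms in auto)

lemma dirichlet_sum_cmult: "I (\<lambda>x. c * f x) = \<bar>c\<bar> powr p * I f"
proof -
  have "E (\<lambda>x. c * f x) = (\<lambda>x. \<bar>c\<bar> powr p * E f x)"
    by (auto simp: local_energy_def sum_distrib_left right_diff_distrib[symmetric] abs_mult powr_mult)
  then show ?thesis by (simp add: dirichlet_sum_def infsum_cmult_right')
qed

lemma finitely_supported_subset_dirichlet: "finitely_supported \<subseteq> D"
proof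
  fix s :: "'v \<Rightarrow> real" assume "s \<in> finitely_supported"
  then have fin: "finite {x. s x \<noteq> 0}" by (simp add: finitely_supported_def)
  define T where "T = {x. s x \<noteq> 0} \<union> (\<Union>x\<in>{x. s x \<noteq> 0}. nbrs adj x)"
  have "finite T" using fin finite_nbrs by (auto simp: T_def)
  have "E s x = 0" if "x \<notin> T" for x
    unfolding local_energy_def
  proof (intro sum.neutral ballI)
    fix y assume "y \<in> nbrs adj x"
    then have "s x = 0" "s y = 0" using that adj_sym by (auto simp: T_def nbrs_def)
    then show "\<bar>s y - s x\<bar> powr p = 0" by simp
  qed
  then have "E s summable_on UNIV \<longleftrightarrow> E s summable_on T"
    by (intro summable_on_cong_neutral) auto
  then show "s \<in> D" using \<open>finite T\<close> by (simp add: dirichlet_space_def)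
qed

text \<open>The energy controls the difference across each edge, hence along any path. On a connected graph
  vanishing energy therefore propagates convergence from one vertex to all others.\<close>

lemma tendsto_zero_if_dirichlet_sum:
  assumes D: "\<And>k. u k \<in> D" and I: "((\<lambda>k. I (u k)) \<longlongrightarrow> 0) F" and o: "((\<lambda>k. u k v) \<longlongrightarrow> 0) F"
  shows "((\<lambda>k. u k x) \<longlongrightarrow> 0) F"
  using connected[of v x]
proof induction
  case (step y z)
  have "\<bar>u k z - u k y\<bar> \<le> I (u k) powr (1 / p)" for k
  proof -
    have "\<bar>u k z - u k y\<bar> = (\<bar>u k z - u k y\<bar> powr p) powr (1 / p)"
      using p by (simp add: powr_powr)
    also have "\<dots> \<le> I (u k) powr (1 / p)"
      using p edge_le_dirichlet_sum[OF D step(2)] by (intro powr_mono2) auto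
    finally show ?thesis .
  qed
  moreover have "((\<lambda>k. I (u k) powr (1 / p)) \<longlongrightarrow> 0) F"
    using p dirichlet_sum_nonneg by (intro tendsto_zero_powrI[OF I tendsto_const]) auto
  ultimately have "((\<lambda>k. u k z - u k y) \<longlongrightarrow> 0) F"
    by (intro Lim_null_comparison[of "\<lambda>k. u k z - u k y" "\<lambda>k. I (u k) powr (1 / p)"]) auto
  from tendsto_add[OF this step.IH] show ?case by simp
qed (rule o)

lemma constant_if_dirichlet_sum_zero:
  assumes "f \<in> D" "I f = 0"
  shows "f x = f v"
  using connected[of v x]
proof induction
  case (step y z)
  have "\<bar>f z - f y\<bar> powr p \<le> 0" using edge_le_dirichlet_sum[OF assms(1) step(2)] assms by simp
  then show ?case using step by simp
qed simp

lemma local_energy_tendsto: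
  assumes "\<And>x. ((\<lambda>k. u k x) \<longlongrightarrow> f x) F"
  shows "((\<lambda>k. E (u k) x) \<longlongrightarrow> E f x) F"
  unfolding local_energy_def
proof (intro tendsto_sum)
  fix y
  have "((\<lambda>k. u k y - u k x) \<longlongrightarrow> f y - f x) F" by (intro tendsto_intros assms)
  moreover have "isCont (\<lambda>t. \<bar>t\<bar> powr p) (f y - f x)"
    using continuous_on_abs_powr[OF p, of UNIV "\<lambda>t::real. t"] by (simp add: continuous_on_eq_continuous_at)
  ultimately show "((\<lambda>k. \<bar>u k y - u k x\<bar> powr p) \<longlongrightarrow> \<bar>f y - f x\<bar> powr p) F"
    by (rule isCont_tendsto_compose[rotated])
qed

text \<open>Fatou's lemma for the energy: finite partial sums pass to pointwise limits.\<close>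

lemma dirichlet_sum_le_of_tendsto:
  assumes F: "F \<noteq> bot" and D: "\<And>k. u k \<in> D" and lim: "\<And>x. ((\<lambda>k. u k x) \<longlongrightarrow> f x) F"
    and le: "eventually (\<lambda>k. I (u k) \<le> c) F"
  shows "f \<in> D" "I f \<le> c"
proof -
  have "sum (E f) S \<le> c" if S: "finite S" for S
  proof (rule tendsto_upperbound[OF tendsto_sum[OF local_energy_tendsto[OF lim]] _ F])
    show "eventually (\<lambda>k. sum (E (u k)) S \<le> c) F"
      using le by eventually_elim (use sum_local_energy_le[OF D S] in \<open>blast intro: order_trans\<close>)
  qed
  then show "f \<in> D" "I f \<le> c" by (auto intro: dirichlet_sum_leI)
qed

section \<open>The closure of the finitely supported functions\<close>

text \<open>The norm of \<open>D\<close> combines energy and the value at \<open>v0\<close>; separating the two makes membership in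
  the closure usable without roots.\<close>

lemma dirichlet_closure_iff:
  "f \<in> C0 \<longleftrightarrow> f \<in> D \<and> (\<exists>s. (\<forall>k. s k \<in> finitely_supported)
      \<and> (\<lambda>k::nat. I (\<lambda>x. f x - s k x)) \<longlonglongrightarrow> 0 \<and> (\<lambda>k. f v0 - s k v0) \<longlonglongrightarrow> 0)"
    (is "?l \<longleftrightarrow> ?r")
proof
  assume f: ?l
  have "\<forall>k::nat. \<exists>s\<in>finitely_supported. dirichlet_norm adj p v0 (\<lambda>x. f x - s x) < inverse (real (Suc k))"
    using f unfolding dirichlet_closure_def by (auto simp del: of_nat_Suc)
  then obtain s where s: "\<And>k. s k \<in> finitely_supported"
    and n: "\<And>k::nat. dirichlet_norm adj p v0 (\<lambda>x. f x - s k x) < inverse (real (Suc k))"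
    by metis
  let ?n = "\<lambda>k. I (\<lambda>x. f x - s k x) + \<bar>f v0 - s k v0\<bar> powr p"
  have bound: "?n k \<le> inverse (real (Suc k)) powr p" for k
  proof -
    have "?n k = (?n k powr (1 / p)) powr p"
      using p dirichlet_sum_nonneg by (simp add: powr_powr)
    also have "\<dots> \<le> inverse (real (Suc k)) powr p"
      using n[of k] p by (intro powr_mono2) (auto simp: dirichlet_norm_def)
    finally show ?thesis .
  qed
  have "(\<lambda>k. inverse (real (Suc k)) powr p) \<longlonglongrightarrow> 0"
    using p by (intro tendsto_zero_powrI[OF LIMSEQ_inverse_real_of_nat tendsto_const]) auto
  then have lim: "?n \<longlonglongrightarrow> 0"
    by (rule tendsto_sandwich[OF _ _ tendsto_const, rotated 2])
       (use bound dirichlet_sum_nonneg in \<open>auto intro!: always_eventually add_nonneg_nonneg\<close>)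
  have 1: "(\<lambda>k. I (\<lambda>x. f x - s k x)) \<longlonglongrightarrow> 0"
    by (rule tendsto_sandwich[OF _ _ tendsto_const lim])
       (use dirichlet_sum_nonneg in \<open>auto intro!: always_eventually\<close>)
  have "(\<lambda>k. \<bar>f v0 - s k v0\<bar> powr p) \<longlonglongrightarrow> 0"
    by (rule tendsto_sandwich[OF _ _ tendsto_const lim])
       (use dirichlet_sum_nonneg in \<open>auto intro!: always_eventually\<close>)
  from tendsto_zero_powrI[OF this tendsto_const, of "1 / p"]
  have "(\<lambda>k. (\<bar>f v0 - s k v0\<bar> powr p) powr (1 / p)) \<longlonglongrightarrow> 0"
    using p by simp
  moreover have "(\<bar>t\<bar> powr p) powr (1 / p) = \<bar>t\<bar>" for t using p by (simp add: powr_powr)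
  ultimately have "(\<lambda>k. \<bar>f v0 - s k v0\<bar>) \<longlonglongrightarrow> 0" by (simp only:)
  then have "(\<lambda>k. f v0 - s k v0) \<longlonglongrightarrow> 0" by (rule tendsto_rabs_zero_cancel)
  then show ?r using 1 s f by (auto simp: dirichlet_closure_def)
next
  assume ?r
  then obtain s where f: "f \<in> D" and s: "\<And>k. s k \<in> finitely_supported"
    and lim: "(\<lambda>k::nat. I (\<lambda>x. f x - s k x)) \<longlonglongrightarrow> 0" "(\<lambda>k. f v0 - s k v0) \<longlonglongrightarrow> 0" by auto
  have "(\<lambda>k. \<bar>f v0 - s k v0\<bar> powr p) \<longlonglongrightarrow> 0"
    using p lim(2) by (intro tendsto_zero_powrI[OF tendsto_rabs_zero tendsto_const]) auto
  from tendsto_add[OF lim(1) this]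
  have "(\<lambda>k. dirichlet_norm adj p v0 (\<lambda>x. f x - s k x)) \<longlonglongrightarrow> 0"
    unfolding dirichlet_norm_def using p dirichlet_sum_nonneg
    by (intro tendsto_zero_powrI[OF _ tendsto_const]) (auto intro!: always_eventually add_nonneg_nonneg)
  then have "\<exists>k. dirichlet_norm adj p v0 (\<lambda>x. f x - s k x) < e" if "0 < e" for e
    using order_tendstoD(2)[OF _ that] eventually_happens by fastforce
  then show ?l using f s unfolding dirichlet_closure_def by fast
qed

lemma dirichlet_closureE:
  assumes "f \<in> C0"
  obtains s where "\<And>k. s k \<in> finitely_supported" "\<And>k. s k \<in> D" "f \<in> D"
    "(\<lambda>k::nat. I (\<lambda>x. f x - s k x)) \<longlonglongrightarrow> 0" "\<And>x. (\<lambda>k. f x - s k x) \<longlonglongrightarrow> 0"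
proof -
  from assms obtain s where s: "\<And>k. s k \<in> finitely_supported" and f: "f \<in> D"
    and lim: "(\<lambda>k::nat. I (\<lambda>x. f x - s k x)) \<longlonglongrightarrow> 0" "(\<lambda>k. f v0 - s k v0) \<longlonglongrightarrow> 0"
    unfolding dirichlet_closure_iff by blast
  have sD: "s k \<in> D" for k using s finitely_supported_subset_dirichlet by blast
  have "(\<lambda>k. f x - s k x) \<longlonglongrightarrow> 0" for x
    by (rule tendsto_zero_if_dirichlet_sum[of "\<lambda>k x. f x - s k x", OF _ lim(1) lim(2)])
       (intro dirichlet_space_diff f sD)
  then show ?thesis using that s f sD lim by blast
qed

lemma finitely_supported_subset_closure: "finitely_supported \<subseteq> C0"
proof
  fix s :: "'v \<Rightarrow> real" assume s: "s \<in> finitely_supported"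
  have "E (\<lambda>x. 0) = (\<lambda>x. 0)" by (simp add: local_energy_def fun_eq_iff)
  then have "I (\<lambda>x. 0) = 0" by (simp add: dirichlet_sum_def)
  then show "s \<in> C0" unfolding dirichlet_closure_iff using s finitely_supported_subset_dirichlet
    by (auto intro!: exI[of _ "\<lambda>_. s"])
qed

lemma finitely_supported_add:
  "s \<in> finitely_supported \<Longrightarrow> t \<in> finitely_supported \<Longrightarrow> (\<lambda>x. s x + t x :: real) \<in> finitely_supported"
  unfolding finitely_supported_def mem_Collect_eq
  by (rule finite_subset[of _ "{x. s x \<noteq> 0} \<union> {x. t x \<noteq> 0}"]) auto

lemma dirichlet_closure_add:
  assumes "f \<in> C0" "g \<in> C0"
  shows "(\<lambda>x. f x + g x) \<in> C0"
proof -
  obtain s where s: "\<And>k. s k \<in> finitely_supported" "\<And>k. s k \<in> D" "f \<in> D"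
    "(\<lambda>k::nat. I (\<lambda>x. f x - s k x)) \<longlonglongrightarrow> 0" "\<And>x. (\<lambda>k. f x - s k x) \<longlonglongrightarrow> 0"
    using assms(1) by (rule dirichlet_closureE) blast
  obtain t where t: "\<And>k. t k \<in> finitely_supported" "\<And>k. t k \<in> D" "g \<in> D"
    "(\<lambda>k::nat. I (\<lambda>x. g x - t k x)) \<longlonglongrightarrow> 0" "\<And>x. (\<lambda>k. g x - t k x) \<longlonglongrightarrow> 0"
    using assms(2) by (rule dirichlet_closureE) blast
  let ?u = "\<lambda>k x. (f x - s k x) + (g x - t k x)"
  have "(\<lambda>k. 2 powr p * I (\<lambda>x. f x - s k x) + 2 powr p * I (\<lambda>x. g x - t k x)) \<longlonglongrightarrow> 0"
    by (intro tendsto_add_zero tendsto_mult_right_zero s t)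
  then have lim: "(\<lambda>k. I (?u k)) \<longlonglongrightarrow> 0"
    by (rule tendsto_sandwich[OF _ _ tendsto_const, rotated 2])
       (use s t in \<open>auto intro!: always_eventually dirichlet_sum_nonneg dirichlet_sum_add_le dirichlet_space_diff\<close>)
  have eq: "f x + g x - (s k x + t k x) = ?u k x" for k x by simp
  have "(\<lambda>k. ?u k v0) \<longlonglongrightarrow> 0" using tendsto_add[OF s(5)[of v0] t(5)[of v0]] by simp
  then show ?thesis unfolding dirichlet_closure_iff
    using lim s t by (intro conjI exI[of _ "\<lambda>k x. s k x + t k x"])
      (auto simp: eq intro!: dirichlet_space_add finitely_supported_add)
qed

lemma dirichlet_closure_cmult:
  assumes "f \<in> C0"
  shows "(\<lambda>x. c * f x) \<in> C0"
proof -
  obtain s where s: "\<And>k. s k \<in> finitely_supported" "\<And>k. s k \<in> D" "f \<in> D"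
    "(\<lambda>k::nat. I (\<lambda>x. f x - s k x)) \<longlonglongrightarrow> 0" "\<And>x. (\<lambda>k. f x - s k x) \<longlonglongrightarrow> 0"
    using assms(1) by (rule dirichlet_closureE) blast
  have eq: "c * f x - c * s k x = c * (f x - s k x)" for k x by (simp add: algebra_simps)
  have "(\<lambda>x. c * s k x) \<in> finitely_supported" for k
    using s(1)[of k] unfolding finitely_supported_def mem_Collect_eq by (rule rev_finite_subset) auto
  then show ?thesis unfolding dirichlet_closure_iff
    using s by (intro conjI exI[of _ "\<lambda>k x. c * s k x"])
      (auto simp: eq dirichlet_sum_cmult intro!: dirichlet_space_cmult tendsto_mult_right_zero)
qed

lemma dirichlet_closure_closed:
  assumes u: "\<And>k::nat. u k \<in> C0" and f: "f \<in> D"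
    and I: "(\<lambda>k. I (\<lambda>x. f x - u k x)) \<longlonglongrightarrow> 0" and o: "(\<lambda>k. f v0 - u k v0) \<longlonglongrightarrow> 0"
  shows "f \<in> C0"
proof -
  have "\<exists>s. s \<in> finitely_supported \<and> I (\<lambda>x. u k x - s x) < inverse (real (Suc k))
      \<and> \<bar>u k v0 - s v0\<bar> < inverse (real (Suc k))" for k
  proof -
    obtain s where s: "\<And>j. s j \<in> finitely_supported"
      "(\<lambda>j::nat. I (\<lambda>x. u k x - s j x)) \<longlonglongrightarrow> 0" "\<And>x. (\<lambda>j. u k x - s j x) \<longlonglongrightarrow> 0"
      using u[of k] by (rule dirichlet_closureE) blast
    have pos: "0 < inverse (real (Suc k))" by simp
    have "\<forall>\<^sub>F j in sequentially. I (\<lambda>x. u k x - s j x) < inverse (real (Suc k))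
      \<and> \<bar>u k v0 - s j v0\<bar> < inverse (real (Suc k))"
      using order_tendstoD(2)[OF s(2) pos] order_tendstoD(2)[OF tendsto_rabs_zero[OF s(3)[of v0]] pos]
      by eventually_elim simp
    then show ?thesis using s(1) eventually_happens[of _ sequentially] by fastforce
  qed
  then obtain s where s: "\<And>k. s k \<in> finitely_supported"
      "\<And>k. I (\<lambda>x. u k x - s k x) < inverse (real (Suc k))"
      "\<And>k. \<bar>u k v0 - s k v0\<bar> < inverse (real (Suc k))" by metis
  have 1: "(\<lambda>k. I (\<lambda>x. u k x - s k x)) \<longlonglongrightarrow> 0"
    by (rule tendsto_sandwich[OF _ _ tendsto_const LIMSEQ_inverse_real_of_nat])
       (use s in \<open>auto intro!: always_eventually dirichlet_sum_nonneg intro: less_imp_le simp del: of_nat_Suc\<close>)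
  have 2: "(\<lambda>k. u k v0 - s k v0) \<longlonglongrightarrow> 0"
    by (rule Lim_null_comparison[OF _ LIMSEQ_inverse_real_of_nat])
       (use s in \<open>auto intro!: always_eventually intro: less_imp_le simp del: of_nat_Suc\<close>)
  have uD: "u k \<in> D" "s k \<in> D" for k
    using u s(1) finitely_supported_subset_dirichlet by (auto simp: dirichlet_closure_def)
  have eq: "f x - s k x = (f x - u k x) + (u k x - s k x)" for k x by simp
  have lim: "(\<lambda>k. 2 powr p * I (\<lambda>x. f x - u k x) + 2 powr p * I (\<lambda>x. u k x - s k x)) \<longlonglongrightarrow> 0"
    by (intro tendsto_add_zero tendsto_mult_right_zero 1 I)
  have le: "I (\<lambda>x. (f x - u k x) + (u k x - s k x))
      \<le> 2 powr p * I (\<lambda>x. f x - u k x) + 2 powr p * I (\<lambda>x. u k x - s k x)" for k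
    by (intro dirichlet_sum_add_le dirichlet_space_diff f uD)
  have "(\<lambda>k. I (\<lambda>x. (f x - u k x) + (u k x - s k x))) \<longlonglongrightarrow> 0"
  proof (rule tendsto_sandwich[OF _ _ tendsto_const lim])
    show "\<forall>\<^sub>F k in sequentially. 0 \<le> I (\<lambda>x. (f x - u k x) + (u k x - s k x))"
      using dirichlet_sum_nonneg by (rule always_eventually[OF allI])
    show "\<forall>\<^sub>F k in sequentially. I (\<lambda>x. (f x - u k x) + (u k x - s k x))
      \<le> 2 powr p * I (\<lambda>x. f x - u k x) + 2 powr p * I (\<lambda>x. u k x - s k x)"
      using le by (rule always_eventually[OF allI])
  qed
  then have "(\<lambda>k. I (\<lambda>x. f x - s k x)) \<longlonglongrightarrow> 0" by simp
  moreover have "(\<lambda>k. f v0 - s k v0) \<longlonglongrightarrow> 0"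
    unfolding eq using tendsto_add[OF o 2] by simp
  ultimately show ?thesis unfolding dirichlet_closure_iff using f s(1) by blast
qed

text \<open>If \<open>s k\<close> are finitely supported approximations of \<open>g\<close>, then \<open>\<phi> (s k)\<close> are approximations of
  \<open>\<phi> \<circ> g\<close>, although composition with \<open>\<phi>\<close> is not Lipschitz for the energy. The increments of
  \<open>\<phi> \<circ> g - \<phi> \<circ> s k\<close> are at most twice those of \<open>g\<close> plus those of \<open>g - s k\<close>. So outside a finite set
  carrying almost all energy of \<open>g\<close> they have small energy, and on the finite set pointwise
  convergence suffices.\<close>

lemma dirichlet_closure_normal_contraction:
  assumes g: "g \<in> C0" and contr: "\<And>s t. \<bar>\<phi> s - \<phi> t\<bar> \<le> \<bar>s - t\<bar>" and zero: "\<phi> 0 = (0::real)"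
  shows "(\<lambda>x. \<phi> (g x)) \<in> C0"
proof -
  obtain s where s: "\<And>k. s k \<in> finitely_supported" "\<And>k. s k \<in> D" "g \<in> D"
    "(\<lambda>k::nat. I (\<lambda>x. g x - s k x)) \<longlonglongrightarrow> 0" "\<And>x. (\<lambda>k. g x - s k x) \<longlonglongrightarrow> 0"
    using g by (rule dirichlet_closureE) blast
  let ?u = "\<lambda>k x. \<phi> (g x) - \<phi> (s k x)" and ?v = "\<lambda>k x. g x - s k x"
  define c where "c = 2 powr p * (2 powr p)"
  define d where "d = (2::real) powr p"
  have c: "0 < c" and d: "0 < d" by (auto simp: c_def d_def)
  have u0: "(\<lambda>k. ?u k x) \<longlonglongrightarrow> 0" for x
    using tendsto_rabs_zero[OF s(5)[of x]] by (rule Lim_null_comparison[rotated]) (simp add: contr)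
  have le: "E (?u k) x \<le> c * E g x + d * E (?v k) x" for k x
  proof (rule local_energy_le_combination)
    fix x y
    have "\<bar>?u k y - ?u k x\<bar> \<le> \<bar>\<phi> (g y) - \<phi> (g x)\<bar> + \<bar>\<phi> (s k y) - \<phi> (s k x)\<bar>" by linarith
    also have "\<dots> \<le> \<bar>g y - g x\<bar> + \<bar>s k y - s k x\<bar>" by (intro add_mono contr)
    also have "\<dots> \<le> 2 * \<bar>g y - g x\<bar> + \<bar>?v k y - ?v k x\<bar>"
    proof -
      have "?v k y - ?v k x = (g y - g x) - (s k y - s k x)" by simp
      moreover have "\<bar>a\<bar> + \<bar>b\<bar> \<le> 2 * \<bar>a\<bar> + \<bar>a - b\<bar>" for a b :: real by linarith
      ultimately show ?thesis by (simp only:)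
    qed
    also have "\<dots> = \<bar>2 * \<bar>g y - g x\<bar> + \<bar>?v k y - ?v k x\<bar>\<bar>" by simp
    finally have "\<bar>?u k y - ?u k x\<bar> powr p \<le> \<bar>2 * \<bar>g y - g x\<bar> + \<bar>?v k y - ?v k x\<bar>\<bar> powr p"
      using p by (intro powr_mono2) auto
    also have "\<dots> \<le> c * \<bar>g y - g x\<bar> powr p + d * \<bar>?v k y - ?v k x\<bar> powr p"
      using abs_powr_add_le[OF p, of "2 * \<bar>g y - g x\<bar>" "\<bar>?v k y - ?v k x\<bar>"]
      by (simp add: c_def d_def abs_mult powr_mult)
    finally show "\<bar>?u k y - ?u k x\<bar> powr p \<le> \<dots>" .
  qed
  have phiD: "(\<lambda>x. \<phi> (f x)) \<in> D" if "f \<in> D" for f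
    by (rule dirichlet_space_if_increments_le[where g = f and k = f and a = 1 and b = 0])
       (simp_all add: that contr)
  have vD: "?v k \<in> D" for k using s by (intro dirichlet_space_diff)
  have "(\<lambda>k. I (?u k)) \<longlonglongrightarrow> 0"
  proof (rule order_tendstoI)
    fix e :: real assume e: "0 < e"
    \<comment> \<open>three contributions of at most \<open>e / 4\<close>: the finite set \<open>T\<close>, the tail of \<open>g\<close>, and \<open>g - s k\<close>\<close>
    have e': "0 < e / (4 * c)" using c e by simp
    obtain T where T: "finite T" "dist (sum (E g) T) (infsum (E g) UNIV) \<le> e / (4 * c)"
      using infsum_finite_approximation[OF _ e', of "E g" UNIV] s(3) by (auto simp: dirichlet_space_def)
    have tail: "sum (E g) (S - T) \<le> e / (4 * c)" if "finite S" for S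
    proof -
      have "sum (E g) T + sum (E g) (S - T) = sum (E g) (T \<union> (S - T))"
        using T that by (intro sum.union_disjoint[symmetric]) auto
      also have "\<dots> \<le> I g" using s T that by (intro sum_local_energy_le) auto
      finally show ?thesis using T(2) by (auto simp: dirichlet_sum_def dist_real_def)
    qed
    have "(\<lambda>k. sum (E (?u k)) T) \<longlonglongrightarrow> sum (E (\<lambda>x. 0)) T"
      by (intro tendsto_sum local_energy_tendsto u0)
    then have "(\<lambda>k. sum (E (?u k)) T) \<longlonglongrightarrow> 0" by (simp add: local_energy_def)
    then have "\<forall>\<^sub>F k in sequentially. sum (E (?u k)) T < e / 4"
      using e by (intro order_tendstoD(2)) auto
    moreover have "\<forall>\<^sub>F k in sequentially. I (?v k) < e / (4 * d)"
      using e d s(4) by (intro order_tendstoD(2)) auto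
    ultimately show "\<forall>\<^sub>F k in sequentially. I (?u k) < e"
    proof eventually_elim
      case (elim k)
      have "I (?u k) \<le> e / 4 + e / 4 + e / 4"
      proof (rule dirichlet_sum_leI)
        fix S :: "'v set" assume S: "finite S"
        have "sum (E (?u k)) S \<le> sum (E (?u k)) (T \<union> (S - T))"
          using S T by (intro sum_mono2) (auto simp: local_energy_nonneg)
        also have "\<dots> = sum (E (?u k)) T + sum (E (?u k)) (S - T)"
          using S T by (intro sum.union_disjoint) auto
        also have "sum (E (?u k)) (S - T) \<le> (\<Sum>x\<in>S-T. c * E g x + d * E (?v k) x)"
          by (intro sum_mono le)
        also have "\<dots> = c * sum (E g) (S - T) + d * sum (E (?v k)) (S - T)"
          by (simp add: sum.distrib sum_distrib_left)
        also have "\<dots> \<le> c * (e / (4 * c)) + d * (e / (4 * d))"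
        proof (intro add_mono mult_left_mono tail S)
          have "sum (E (?v k)) (S - T) \<le> I (?v k)" using vD S by (intro sum_local_energy_le) auto
          then show "sum (E (?v k)) (S - T) \<le> e / (4 * d)" using elim by linarith
        qed (use c d in auto)
        also have "\<dots> = e / 4 + e / 4" using c d by simp
        finally show "sum (E (?u k)) S \<le> e / 4 + e / 4 + e / 4" using elim by linarith
      qed
      then show ?case using e by linarith
    qed
  next
    fix e :: real assume "e < 0"
    then show "\<forall>\<^sub>F k in sequentially. e < I (?u k)"
      using dirichlet_sum_nonneg by (auto intro!: always_eventually intro: less_le_trans)
  qed
  moreover have "(\<lambda>x. \<phi> (s k x)) \<in> finitely_supported" for k
    using s(1)[of k] unfolding finitely_supported_def mem_Collect_eq
    by (rule rev_finite_subset) (auto simp: zero)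
  ultimately show ?thesis unfolding dirichlet_closure_iff
    using u0 phiD[OF s(3)] by (auto intro!: exI[of _ "\<lambda>k x. \<phi> (s k x)"])
qed

lemma dirichlet_closure_abs: "g \<in> C0 \<Longrightarrow> (\<lambda>x. \<bar>g x\<bar>) \<in> C0"
  by (rule dirichlet_closure_normal_contraction[where \<phi> = abs]) auto

section \<open>The p-Laplacian and variations of the energy\<close>

lemma p_laplacian_eq: "L f x = (\<Sum>y\<in>nbrs adj x. signed_powr p (f y - f x))"
  by (simp add: p_laplacian_def signed_powr_def)

lemma p_laplacian_minus: "L (\<lambda>x. - f x) x = - L f x"
proof -
  have "- f y - - f x = - (f y - f x)" for y by simp
  then show ?thesis by (simp only: p_laplacian_eq signed_powr_minus sum_negf)
qed

lemma p_laplacian_const: "L (\<lambda>_. c) x = 0"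
  by (simp add: p_laplacian_def)

text \<open>If \<open>f\<close> touches \<open>g\<close> from below at \<open>x\<close>, every increment of \<open>f\<close> from \<open>x\<close> is at most that of \<open>g\<close>.
  This is how an obstacle acts at a contact vertex.\<close>

lemma p_laplacian_mono_at_contact:
  assumes "\<And>y. f y \<le> g y" "f x = g x"
  shows "L f x \<le> L g x"
  unfolding p_laplacian_eq using assms by (intro sum_mono signed_powr_mono p) auto

text \<open>Summation by parts. The set \<open>S\<close> only has to contain every edge on which \<open>g\<close> varies.\<close>

lemma sum_gradient_product_eq:
  assumes g: "finite {x. g x \<noteq> 0}" and S: "finite S"
    and sub: "{x. g x \<noteq> 0} \<union> (\<Union>x\<in>{x. g x \<noteq> 0}. nbrs adj x) \<subseteq> S"
  shows "(\<Sum>x\<in>S. \<Sum>y\<in>nbrs adj x. signed_powr p (w y - w x) * (g y - g x))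
    = - 2 * (\<Sum>x | g x \<noteq> 0. g x * L w x)"
proof -
  let ?A = "\<lambda>x y. signed_powr p (w y - w x)" and ?T = "{x. g x \<noteq> 0}"
  have "(\<Sum>x\<in>S. \<Sum>y\<in>nbrs adj x. ?A x y * g x) = (\<Sum>x\<in>S. g x * L w x)"
    by (simp add: p_laplacian_eq sum_distrib_left mult.commute)
  also have "\<dots> = (\<Sum>x\<in>?T. g x * L w x)"
    using S sub by (intro sum.mono_neutral_right) auto
  finally have 1: "(\<Sum>x\<in>S. \<Sum>y\<in>nbrs adj x. ?A x y * g x) = (\<Sum>x\<in>?T. g x * L w x)" .
  have "(\<Sum>y\<in>nbrs adj x. ?A x y * g y) = (\<Sum>y | y \<in> ?T \<and> adj x y. ?A x y * g y)" for x
    using finite_nbrs[of x] by (intro sum.mono_neutral_right) (auto simp: nbrs_def)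
  then have "(\<Sum>x\<in>S. \<Sum>y\<in>nbrs adj x. ?A x y * g y)
      = (\<Sum>x\<in>S. \<Sum>y | y \<in> ?T \<and> adj x y. ?A x y * g y)" by simp
  also have "\<dots> = (\<Sum>y\<in>?T. \<Sum>x | x \<in> S \<and> adj x y. ?A x y * g y)"
    using g S by (intro sum.swap_restrict) auto
  also have "\<dots> = (\<Sum>y\<in>?T. - (g y * L w y))"
  proof (rule sum.cong[OF refl])
    fix y assume y: "y \<in> ?T"
    have "{x. x \<in> S \<and> adj x y} = nbrs adj y"
      using sub y adj_sym by (auto simp: nbrs_def)
    moreover have "?A x y = - ?A y x" for x
      using signed_powr_minus[of p "w x - w y"] by simp
    ultimately show "(\<Sum>x | x \<in> S \<and> adj x y. ?A x y * g y) = - (g y * L w y)"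
      by (simp add: p_laplacian_eq sum_distrib_left sum_negf mult.commute)
  qed
  finally have 2: "(\<Sum>x\<in>S. \<Sum>y\<in>nbrs adj x. ?A x y * g y) = - (\<Sum>x\<in>?T. g x * L w x)"
    by (simp add: sum_negf)
  show ?thesis using 1 2 by (simp add: right_diff_distrib sum_subtractf)
qed

text \<open>The tangent inequality summed over all edges. It plays a double role: at a p-harmonic \<open>w\<close> it says
  that \<open>w\<close> minimises the energy, and at the perturbed function it replaces the derivative of the
  energy in the Euler-Lagrange argument.\<close>

lemma dirichlet_sum_ge_first_variation:
  assumes w: "w \<in> D" and g: "g \<in> finitely_supported"
  shows "I w - 2 * p * (\<Sum>x | g x \<noteq> 0. g x * L w x) \<le> I (\<lambda>x. w x + g x)"
proof -
  let ?s = "\<Sum>x | g x \<noteq> 0. g x * L w x" and ?v = "\<lambda>x. w x + g x"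
  let ?U = "{x. g x \<noteq> 0} \<union> (\<Union>x\<in>{x. g x \<noteq> 0}. nbrs adj x)"
  have fin: "finite {x. g x \<noteq> 0}" using g by (simp add: finitely_supported_def)
  then have U: "finite ?U" using finite_nbrs by auto
  have vD: "?v \<in> D"
    using subsetD[OF finitely_supported_subset_dirichlet g] by (rule dirichlet_space_add[OF w])
  have "I w \<le> I ?v + 2 * p * ?s"
  proof (rule dirichlet_sum_leI)
    fix S :: "'v set" assume S: "finite S"
    let ?S = "S \<union> ?U"
    have "sum (E w) S \<le> sum (E w) ?S"
      using S U by (intro sum_mono2) (auto simp: local_energy_nonneg)
    also have "\<dots> \<le> (\<Sum>x\<in>?S. E ?v x - p * (\<Sum>y\<in>nbrs adj x. signed_powr p (w y - w x) * (g y - g x)))"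
    proof (rule sum_mono)
      fix x
      have "E w x + p * (\<Sum>y\<in>nbrs adj x. signed_powr p (w y - w x) * (g y - g x)) \<le> E ?v x"
        unfolding local_energy_def sum_distrib_left sum.distrib[symmetric]
      proof (rule sum_mono)
        fix y
        show "\<bar>w y - w x\<bar> powr p + p * (signed_powr p (w y - w x) * (g y - g x)) \<le> \<bar>?v y - ?v x\<bar> powr p"
          using abs_powr_ge_tangent[OF p, of "w y - w x" "?v y - ?v x"] by (simp add: algebra_simps)
      qed
      then show "E w x \<le> E ?v x - p * (\<Sum>y\<in>nbrs adj x. signed_powr p (w y - w x) * (g y - g x))" by simp
    qed
    also have "\<dots> = sum (E ?v) ?S - p * (- 2 * ?s)"
      using sum_gradient_product_eq[OF fin, of ?S w] S U
      by (simp add: sum_subtractf sum_distrib_left[symmetric])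
    also have "\<dots> \<le> I ?v + 2 * p * ?s"
      using sum_local_energy_le[OF vD, of ?S] S U by simp
    finally show "sum (E w) S \<le> I ?v + 2 * p * ?s" .
  qed
  then show ?thesis by simp
qed

text \<open>The tangent inequality at the lowered function bounds its Laplacian at \<open>x\<close> from below by 0; let
  the amount of lowering tend to 0. Only one-sided variations are used, so this applies next to an
  obstacle.\<close>

lemma p_laplacian_nonneg_if_lowering_increases_energy:
  assumes w: "w \<in> D" and d: "0 < d"
    and min: "\<And>t. 0 < t \<Longrightarrow> t \<le> d \<Longrightarrow> I w \<le> I (\<lambda>y. w y - (if y = x then t else 0))"
  shows "0 \<le> L w x"
proof -
  let ?w = "\<lambda>t y. w y - (if y = x then t else 0)"
  have ge: "0 \<le> L (?w t) x" if t: "0 < t" "t \<le> d" for t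
  proof -
    let ?g = "\<lambda>y. if y = x then t else 0"
    have supp: "{y. ?g y \<noteq> 0} = {x}" using t by auto
    then have g: "?g \<in> finitely_supported" by (simp add: finitely_supported_def)
    then have "?w t \<in> D"
      using finitely_supported_subset_dirichlet by (intro dirichlet_space_diff[OF w]) (rule subsetD)
    from dirichlet_sum_ge_first_variation[OF this g]
    have "I (?w t) - 2 * p * (t * L (?w t) x) \<le> I w" by (simp add: supp)
    with min[OF t] have "0 \<le> (2 * p * t) * L (?w t) x" by (simp add: mult.assoc)
    moreover have "0 < 2 * p * t" using p t by simp
    ultimately show ?thesis by (simp only: zero_le_mult_iff) linarith
  qed
  have "((\<lambda>t. \<Sum>y\<in>nbrs adj x. signed_powr p (w y - w x + t)) \<longlongrightarrow>
      (\<Sum>y\<in>nbrs adj x. signed_powr p (w y - w x + 0))) (at_right 0)"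
    by (intro tendsto_sum isCont_tendsto_compose[OF continuous_signed_powr[OF p]] tendsto_intros)
  moreover have "(\<Sum>y\<in>nbrs adj x. signed_powr p (w y - w x + t)) = L (?w t) x" for t
    unfolding p_laplacian_eq using no_loop
    by (intro sum.cong refl arg_cong[where f = "signed_powr p"]) (auto simp: nbrs_def)
  ultimately have lim: "((\<lambda>t. L (?w t) x) \<longlongrightarrow> L w x) (at_right 0)" by (simp add: p_laplacian_eq)
  have "\<forall>\<^sub>F t in at_right 0. 0 \<le> L (?w t) x"
    using d by (intro eventually_at_rightI[of 0 d]) (auto intro: ge)
  then show ?thesis by (rule tendsto_lowerbound[OF lim]) simp
qed

lemma dirichlet_sum_minus: "I (\<lambda>x. - f x) = I f"
  using dirichlet_sum_cmult[of "-1" f] by simp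

lemma dirichlet_space_minus: "f \<in> D \<Longrightarrow> (\<lambda>x. - f x) \<in> D"
  using dirichlet_space_cmult[of f "-1"] by simp

lemma dirichlet_closure_minus: "f \<in> C0 \<Longrightarrow> (\<lambda>x. - f x) \<in> C0"
  using dirichlet_closure_cmult[of f "-1"] by simp

section \<open>Minimisation of the energy\<close>

lemma dirichlet_sum_uniformly_convex:
  assumes "0 < e"
  obtains C where "0 \<le> C" "\<And>f g. f \<in> D \<Longrightarrow> g \<in> D \<Longrightarrow>
    I (\<lambda>x. f x - g x) + C * I (\<lambda>x. (f x + g x) / 2) \<le> (e + C / 2) * (I f + I g)"
proof -
  obtain C where C: "0 \<le> C" "\<And>a b. \<bar>a - b\<bar> powr p + C * \<bar>(a + b) / 2\<bar> powr p
            \<le> (e + C / 2) * (\<bar>a\<bar> powr p + \<bar>b\<bar> powr p)"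
    using abs_powr_uniformly_convex[OF p assms] by blast
  have "I (\<lambda>x. f x - g x) + C * I (\<lambda>x. (f x + g x) / 2) \<le> (e + C / 2) * (I f + I g)"
    if fg: "f \<in> D" "g \<in> D" for f g
  proof -
    let ?d = "\<lambda>x. f x - g x" and ?m = "\<lambda>x. (f x + g x) / 2"
    have dm: "?d \<in> D" "?m \<in> D"
      using dirichlet_space_cmult[OF dirichlet_space_add[OF fg], of "1/2"] dirichlet_space_diff[OF fg]
      by simp_all
    have le: "E ?d x + C * E ?m x \<le> (e + C / 2) * (E f x + E g x)" for x
      unfolding local_energy_def sum_distrib_left sum.distrib[symmetric]
    proof (rule sum_mono)
      fix y
      have "?d y - ?d x = (f y - f x) - (g y - g x)" "?m y - ?m x = ((f y - f x) + (g y - g x)) / 2"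
        by (simp_all add: field_simps)
      then show "\<bar>?d y - ?d x\<bar> powr p + C * \<bar>?m y - ?m x\<bar> powr p
          \<le> (e + C / 2) * (\<bar>f y - f x\<bar> powr p + \<bar>g y - g x\<bar> powr p)"
        using C(2)[of "f y - f x" "g y - g x"] by (simp only:)
    qed
    have s: "E ?d summable_on UNIV" "E ?m summable_on UNIV" "E f summable_on UNIV" "E g summable_on UNIV"
      using dm fg by (simp_all add: dirichlet_space_def)
    have "I ?d + C * I ?m = infsum (\<lambda>x. E ?d x + C * E ?m x) UNIV"
      unfolding dirichlet_sum_def infsum_cmult_right'[symmetric]
      by (intro infsum_add[symmetric] s summable_on_cmult_right)
    also have "\<dots> \<le> infsum (\<lambda>x. (e + C / 2) * (E f x + E g x)) UNIV"
      by (intro infsum_mono le summable_on_add summable_on_cmult_right s)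
    also have "\<dots> = (e + C / 2) * (I f + I g)"
      unfolding dirichlet_sum_def infsum_cmult_right' by (subst infsum_add) (auto intro: s)
    finally show ?thesis .
  qed
  then show ?thesis using that C(1) by blast
qed

text \<open>Two elements of \<open>K\<close> with energy close to the minimum have a midpoint with energy at least
  \<open>m\<close>, so uniform convexity forces their difference to have small energy. This gives both convergence
  of minimising sequences and uniqueness of minimisers up to constants.\<close>

lemma near_minimisers_are_close:
  assumes K: "K \<subseteq> D" and mid: "\<And>f g. f \<in> K \<Longrightarrow> g \<in> K \<Longrightarrow> (\<lambda>x. (f x + g x) / 2) \<in> K"
    and m: "0 \<le> m" "\<And>f. f \<in> K \<Longrightarrow> m \<le> I f" and e: "0 < e"
  shows "\<exists>d>0. \<forall>f\<in>K. \<forall>g\<in>K. I f \<le> m + d \<longrightarrow> I g \<le> m + d \<longrightarrow> I (\<lambda>x. f x - g x) < e"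
proof -
  define c where "c = e / (4 * (m + 1))"
  have c: "0 < c" using e m by (simp add: c_def)
  obtain C where C: "0 \<le> C" "\<And>f g. f \<in> D \<Longrightarrow> g \<in> D \<Longrightarrow>
    I (\<lambda>x. f x - g x) + C * I (\<lambda>x. (f x + g x) / 2) \<le> (c + C / 2) * (I f + I g)"
    using dirichlet_sum_uniformly_convex[OF c] by blast
  define d where "d = min 1 (e / (2 * (C + 1)))"
  have d: "0 < d" "d \<le> 1" "d * (2 * (C + 1)) \<le> e"
  proof -
    show "0 < d" "d \<le> 1" using e C by (auto simp: d_def)
    have "d \<le> e / (2 * (C + 1))" by (simp add: d_def)
    then show "d * (2 * (C + 1)) \<le> e" using C(1) by (simp add: pos_le_divide_eq)
  qed
  have "I (\<lambda>x. f x - g x) < e" if fg: "f \<in> K" "g \<in> K" and le: "I f \<le> m + d" "I g \<le> m + d" for f g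
  proof -
    have "I (\<lambda>x. f x - g x) + C * m \<le> I (\<lambda>x. f x - g x) + C * I (\<lambda>x. (f x + g x) / 2)"
      using C m mid[OF fg] by (intro add_mono mult_left_mono) auto
    also have "\<dots> \<le> (c + C / 2) * (I f + I g)" using C fg K by blast
    also have "\<dots> \<le> (c + C / 2) * (2 * (m + d))" using le c C by (intro mult_left_mono) auto
    also have "\<dots> = 2 * c * (m + d) + C * m + C * d" by (simp add: algebra_simps)
    finally have "I (\<lambda>x. f x - g x) \<le> 2 * c * (m + d) + C * d" by simp
    moreover have "2 * c * (m + d) \<le> 2 * c * (m + 1)" using c d by simp
    moreover have "2 * c * (m + 1) = e / 2" using m by (simp add: c_def divide_simps)
    moreover have "2 * (C * d) < e" using d(1,3) by (simp add: algebra_simps)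
    ultimately show ?thesis by linarith
  qed
  then show ?thesis using d(1) by blast
qed

lemma dirichlet_closure_coset_midpoint:
  assumes "f \<in> D" "g \<in> D" "(\<lambda>x. f x - w x) \<in> C0" "(\<lambda>x. g x - w x) \<in> C0"
  shows "(\<lambda>x. (f x + g x) / 2) \<in> D" "(\<lambda>x. (f x + g x) / 2 - w x) \<in> C0"
proof -
  show "(\<lambda>x. (f x + g x) / 2) \<in> D"
    using dirichlet_space_cmult[OF dirichlet_space_add[OF assms(1,2)], of "1/2"] by simp
  have "(\<lambda>x. (1/2) * ((f x - w x) + (g x - w x))) \<in> C0"
    by (intro dirichlet_closure_add dirichlet_closure_cmult assms)
  moreover have "(1/2) * ((f x - w x) + (g x - w x)) = (f x + g x) / 2 - w x" for x by (simp add: field_simps)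
  ultimately show "(\<lambda>x. (f x + g x) / 2 - w x) \<in> C0" by (simp only:)
qed

text \<open>Energy does not see constants, so a minimising sequence is Cauchy only up to constants. The
  obstacles confine the values at \<open>v0\<close> to a compact interval, and passing to a subsequence that
  converges at \<open>v0\<close> gives strong convergence.\<close>

lemma dirichlet_minimiser_exists:
  assumes f: "f \<in> D" "\<And>x. l x \<le> f x" "\<And>x. f x \<le> u x"
  defines "K \<equiv> {w \<in> D. (\<lambda>x. w x - f x) \<in> C0 \<and> (\<forall>x. l x \<le> w x \<and> w x \<le> u x)}"
  shows "\<exists>w\<in>K. \<forall>v\<in>K. I w \<le> I v"
proof -
  define m where "m = Inf (I ` K)"
  have "(\<lambda>_. 0) \<in> C0"
    using finitely_supported_subset_closure by (auto simp: finitely_supported_def)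
  then have fK: "f \<in> K" using f by (simp add: K_def)
  have bdd: "bdd_below (I ` K)" by (rule bdd_belowI[of _ 0]) (auto simp: dirichlet_sum_nonneg)
  have m_le: "m \<le> I v" if "v \<in> K" for v
    unfolding m_def using that bdd by (auto intro: cInf_lower)
  have m0: "0 \<le> m" unfolding m_def using fK dirichlet_sum_nonneg by (intro cInf_greatest) auto
  have "\<exists>v\<in>K. I v < m + inverse (real (Suc k))" for k
    using cInf_lessD[of "I ` K" "m + inverse (real (Suc k))"] fK unfolding m_def[symmetric]
    by (auto simp del: of_nat_Suc)
  then obtain v where v: "\<And>k. v k \<in> K" "\<And>k. I (v k) < m + inverse (real (Suc k))" by metis
  have "\<forall>k. v k v0 \<in> {l v0..u v0}" using v(1) by (auto simp: K_def)
  then obtain a r where r: "strict_mono r" and a: "((\<lambda>k. v k v0) \<circ> r) \<longlonglongrightarrow> a"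
    using seq_compactE[OF compact_imp_seq_compact[OF compact_Icc], of "\<lambda>k. v k v0"] by metis
  define w where "w k = v (r k)" for k
  have wK: "w k \<in> K" for k using v by (simp add: w_def)
  then have wD: "w k \<in> D" for k by (simp add: K_def)
  have wo: "(\<lambda>k. w k v0) \<longlonglongrightarrow> a" using a by (simp add: w_def o_def)
  have w_near: "\<forall>\<^sub>F k in sequentially. I (w k) \<le> m + d" if "0 < d" for d
  proof -
    have "(\<lambda>k. m + inverse (real (Suc (r k)))) \<longlonglongrightarrow> m + 0"
      using LIMSEQ_subseq_LIMSEQ[OF LIMSEQ_inverse_real_of_nat r] by (intro tendsto_intros) (simp add: o_def)
    then have "\<forall>\<^sub>F k in sequentially. m + inverse (real (Suc (r k))) < m + d"
      using that by (intro order_tendstoD(2)) auto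
    then show ?thesis
    proof eventually_elim
      case (elim k)
      then show ?case using v(2)[of "r k"] unfolding w_def by linarith
    qed
  qed
  have KD: "K \<subseteq> D" by (auto simp: K_def)
  have mid: "(\<lambda>x. (g x + h x) / 2) \<in> K" if "g \<in> K" "h \<in> K" for g h
  proof -
    have "(\<lambda>x. (g x + h x) / 2) \<in> D" "(\<lambda>x. (g x + h x) / 2 - f x) \<in> C0"
      using that by (auto simp: K_def intro: dirichlet_closure_coset_midpoint)
    moreover have "l x \<le> (g x + h x) / 2 \<and> (g x + h x) / 2 \<le> u x" for x
    proof -
      have "l x \<le> g x" "g x \<le> u x" "l x \<le> h x" "h x \<le> u x" using that by (auto simp: K_def)
      then show ?thesis by simp
    qed
    ultimately show ?thesis by (simp add: K_def)
  qed
  have cauchy: "\<forall>\<^sub>F k in sequentially. \<forall>\<^sub>F j in sequentially. I (\<lambda>x. w j x - w k x) \<le> e"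
    and cauchy2: "\<forall>\<^sub>F z in sequentially \<times>\<^sub>F sequentially. I (\<lambda>x. w (fst z) x - w (snd z) x) < e"
    if e: "0 < e" for e
  proof -
    obtain d where d: "0 < d" "\<And>f g. f \<in> K \<Longrightarrow> g \<in> K \<Longrightarrow> I f \<le> m + d \<Longrightarrow> I g \<le> m + d
        \<Longrightarrow> I (\<lambda>x. f x - g x) < e"
      using near_minimisers_are_close[OF KD mid m0 m_le e] by blast
    show "\<forall>\<^sub>F k in sequentially. \<forall>\<^sub>F j in sequentially. I (\<lambda>x. w j x - w k x) \<le> e"
      using w_near[OF d(1)]
    proof eventually_elim
      case (elim k)
      show ?case using w_near[OF d(1)]
        by eventually_elim (use d(2)[OF wK wK] elim in \<open>auto intro: less_imp_le\<close>)
    qed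
    obtain N where "\<And>k. k \<ge> N \<Longrightarrow> I (w k) \<le> m + d"
      using w_near[OF d(1)] by (auto simp: eventually_sequentially)
    then show "\<forall>\<^sub>F z in sequentially \<times>\<^sub>F sequentially. I (\<lambda>x. w (fst z) x - w (snd z) x) < e"
      unfolding eventually_prod_sequentially using d(2)[OF wK wK] by (intro exI[of _ N]) auto
  qed
  have "convergent (\<lambda>k. w k x)" for x
  proof -
    let ?F = "sequentially \<times>\<^sub>F sequentially"
    have "((\<lambda>z. I (\<lambda>x. w (fst z) x - w (snd z) x)) \<longlongrightarrow> 0) ?F"
    proof (rule order_tendstoI)
      fix e :: real assume "e < 0"
      then show "\<forall>\<^sub>F z in ?F. e < I (\<lambda>x. w (fst z) x - w (snd z) x)"
        using dirichlet_sum_nonneg by (auto intro!: always_eventually intro: less_le_trans)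
    qed (rule cauchy2)
    moreover have "((\<lambda>z. w (fst z) v0 - w (snd z) v0) \<longlongrightarrow> 0) ?F"
      using tendsto_diff[OF filterlim_compose[OF wo filterlim_fst] filterlim_compose[OF wo filterlim_snd]]
      by simp
    ultimately have "((\<lambda>z. w (fst z) x - w (snd z) x) \<longlongrightarrow> 0) ?F"
      using tendsto_zero_if_dirichlet_sum[of "\<lambda>z x. w (fst z) x - w (snd z) x" ?F v0 x] wD
      by (simp add: dirichlet_space_diff)
    then have "\<forall>\<^sub>F z in ?F. \<bar>w (fst z) x - w (snd z) x\<bar> < e" if "0 < e" for e
      using order_tendstoD(2)[OF tendsto_rabs_zero that] by blast
    then have "Cauchy (\<lambda>k. w k x)"
      unfolding Cauchy_def dist_real_def eventually_prod_sequentially by (metis fst_conv snd_conv)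
    then show ?thesis by (simp add: Cauchy_convergent_iff)
  qed
  then obtain z where z: "\<And>x. (\<lambda>k. w k x) \<longlonglongrightarrow> z x" unfolding convergent_def by metis
  have zD: "z \<in> D"
    using dirichlet_sum_le_of_tendsto(1)[OF _ wD z w_near[OF zero_less_one]] by simp
  have zm: "I z \<le> m"
    by (rule field_le_epsilon, rule dirichlet_sum_le_of_tendsto(2)[OF _ wD z w_near]) simp_all
  have zl: "l x \<le> z x" for x
    by (rule LIMSEQ_le_const[OF z]) (use wK in \<open>auto simp: K_def\<close>)
  have zu: "z x \<le> u x" for x
    by (rule LIMSEQ_le_const2[OF z]) (use wK in \<open>auto simp: K_def\<close>)
  have "(\<lambda>k. I (\<lambda>x. z x - w k x)) \<longlonglongrightarrow> 0"
  proof (rule order_tendstoI)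
    fix e :: real assume e: "0 < e"
    then have "0 < e / 2" by simp
    from cauchy[OF this] show "\<forall>\<^sub>F k in sequentially. I (\<lambda>x. z x - w k x) < e"
    proof eventually_elim
      case (elim k)
      have "I (\<lambda>x. z x - w k x) \<le> e / 2"
        by (rule dirichlet_sum_le_of_tendsto(2)[OF _ _ _ elim])
           (auto intro: dirichlet_space_diff wD tendsto_intros z)
      then show ?case using e by simp
    qed
  next
    fix e :: real assume "e < 0"
    then show "\<forall>\<^sub>F k in sequentially. e < I (\<lambda>x. z x - w k x)"
      using dirichlet_sum_nonneg by (auto intro!: always_eventually intro: less_le_trans)
  qed
  moreover have "(\<lambda>k. z v0 - w k v0) \<longlonglongrightarrow> 0"
    using tendsto_diff[OF tendsto_const z] by (metis diff_self)
  moreover have "z x - f x - (w k x - f x) = z x - w k x" for k x by simp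
  moreover have "(\<lambda>x. w k x - f x) \<in> C0" for k using wK by (simp add: K_def)
  ultimately have "(\<lambda>x. z x - f x) \<in> C0"
    using dirichlet_closure_closed[of "\<lambda>k x. w k x - f x" "\<lambda>x. z x - f x"] dirichlet_space_diff[OF zD f(1)]
    by (simp only:)
  then show ?thesis
    using zD zl zu order_trans[OF zm m_le] by (intro bexI[of _ z] ballI) (auto simp: K_def)
qed

text \<open>For the minimiser \<open>w\<close> and any vertex, either \<open>w\<close> can be lowered slightly, so
  \<open>L w \<ge> 0\<close> by minimality, or \<open>w\<close> touches \<open>l\<close>, so \<open>L w \<ge> L l \<ge> 0\<close>. The opposite inequality is the same
  argument for \<open>- w\<close> and the obstacle \<open>u\<close>. The obstacles may have infinite energy, as may happen for the
  bounded p-harmonic obstacle in the uniqueness argument.\<close>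

theorem p_harmonic_between_obstacles:
  assumes f: "f \<in> D" "\<And>x. l x \<le> f x" "\<And>x. f x \<le> u x"
    and l: "\<And>x. 0 \<le> L l x" and u: "\<And>x. L u x \<le> 0"
  shows "\<exists>w\<in>D. p_harmonic adj p w \<and> (\<lambda>x. w x - f x) \<in> C0 \<and> (\<forall>x. l x \<le> w x \<and> w x \<le> u x)"
proof -
  define K where "K = {w \<in> D. (\<lambda>x. w x - f x) \<in> C0 \<and> (\<forall>x. l x \<le> w x \<and> w x \<le> u x)}"
  have "\<exists>w\<in>K. \<forall>v\<in>K. I w \<le> I v"
    unfolding K_def by (rule dirichlet_minimiser_exists[OF f])
  then obtain w where w: "w \<in> K" and min_K: "\<forall>v\<in>K. I w \<le> I v" by (rule bexE)
  have min: "I w \<le> I v" if "v \<in> K" for v using min_K that by (rule bspec)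
  have wD: "w \<in> D" and wf: "(\<lambda>x. w x - f x) \<in> C0"
    and lw: "\<And>x. l x \<le> w x" and wu: "\<And>x. w x \<le> u x" using w by (auto simp: K_def)
  have bump: "(\<lambda>y. if y = x then t else 0) \<in> finitely_supported" for x and t :: real
    unfolding finitely_supported_def by (auto intro: finite_subset[of _ "{x}"])
  have min': "I w \<le> I (\<lambda>y. w y + (if y = x then t else 0))"
    if "l x \<le> w x + t" "w x + t \<le> u x" for x t
  proof (rule min)
    let ?b = "\<lambda>y. if y = x then t else 0"
    have 1: "(\<lambda>y. w y + ?b y) \<in> D"
      using subsetD[OF finitely_supported_subset_dirichlet bump] by (rule dirichlet_space_add[OF wD])
    have "(\<lambda>y. (w y - f y) + ?b y) \<in> C0"
      using subsetD[OF finitely_supported_subset_closure bump] by (rule dirichlet_closure_add[OF wf])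
    moreover have "(w y - f y) + ?b y = w y + ?b y - f y" for y by simp
    ultimately have 2: "(\<lambda>y. w y + ?b y - f y) \<in> C0" by (simp only:)
    have "l y \<le> w y + ?b y \<and> w y + ?b y \<le> u y" for y
      using that lw[of y] wu[of y] by auto
    with 1 2 show "(\<lambda>y. w y + ?b y) \<in> K" by (simp add: K_def)
  qed
  have "0 \<le> L w x" for x
  proof (cases "w x = l x")
    case True
    then show ?thesis using p_laplacian_mono_at_contact[of l w x] l[of x] lw by auto
  next
    case False
    show ?thesis
    proof (rule p_laplacian_nonneg_if_lowering_increases_energy[OF wD, of "w x - l x"])
      show "0 < w x - l x" using False lw[of x] by simp
      fix t assume t: "0 < t" "t \<le> w x - l x"
      have "(\<lambda>y. w y + (if y = x then - t else 0)) = (\<lambda>y. w y - (if y = x then t else 0))" by auto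
      then show "I w \<le> I (\<lambda>y. w y - (if y = x then t else 0))"
        using min'[of x "- t"] t wu[of x] by simp
    qed
  qed
  moreover have "L w x \<le> 0" for x
  proof (cases "w x = u x")
    case True
    then show ?thesis using p_laplacian_mono_at_contact[of w u x] u[of x] wu by auto
  next
    case False
    have "0 \<le> L (\<lambda>y. - w y) x"
    proof (rule p_laplacian_nonneg_if_lowering_increases_energy[OF dirichlet_space_minus[OF wD], of "u x - w x"])
      show "0 < u x - w x" using False wu[of x] by simp
      fix t assume t: "0 < t" "t \<le> u x - w x"
      have "(\<lambda>y. - (w y + (if y = x then t else 0))) = (\<lambda>y. - w y - (if y = x then t else 0))" by auto
      then show "I (\<lambda>y. - w y) \<le> I (\<lambda>y. - w y - (if y = x then t else 0))"
        using min'[of x t] t lw[of x] dirichlet_sum_minus[of "\<lambda>y. w y + (if y = x then t else 0)"]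
        by (simp add: dirichlet_sum_minus)
    qed
    then show ?thesis by (simp add: p_laplacian_minus)
  qed
  ultimately have "p_harmonic adj p w" unfolding p_harmonic_def by (simp add: order_antisym)
  then show ?thesis using wD wf lw wu by blast
qed

text \<open>For finitely supported variations this is the tangent inequality. It extends to the closure since
  \<open>I (h + s) \<le> (1 + c) * I (h + g) + C * I (s - g)\<close> with \<open>c\<close> as small as desired.\<close>

lemma p_harmonic_minimises:
  assumes h: "h \<in> D" "p_harmonic adj p h" and g: "g \<in> C0"
  shows "I h \<le> I (\<lambda>x. h x + g x)"
proof (rule field_le_epsilon)
  fix e :: real assume e: "0 < e"
  let ?v = "\<lambda>x. h x + g x"
  obtain s where s: "\<And>k. s k \<in> finitely_supported" "\<And>k. s k \<in> D" "g \<in> D"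
    "(\<lambda>k::nat. I (\<lambda>x. g x - s k x)) \<longlonglongrightarrow> 0" "\<And>x. (\<lambda>k. g x - s k x) \<longlonglongrightarrow> 0"
    using g by (rule dirichlet_closureE) blast
  define c where "c = e / (I ?v + 1)"
  have I1: "0 < I ?v + 1" using dirichlet_sum_nonneg[of ?v] by linarith
  then have c: "0 < c" using e by (simp add: c_def)
  obtain C where C: "0 \<le> C" "\<And>a b. \<bar>a + b\<bar> powr p \<le> (1 + c) * \<bar>a\<bar> powr p + C * \<bar>b\<bar> powr p"
    using abs_powr_add_le_eps[OF p c] by blast
  have "I h \<le> (1 + c) * I ?v + C * I (\<lambda>x. g x - s k x)" for k
  proof -
    have "I h \<le> I (\<lambda>x. h x + s k x)"
      using dirichlet_sum_ge_first_variation[OF h(1) s(1)[of k]] h(2) by (simp add: p_harmonic_def)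
    also have "\<dots> \<le> (1 + c) * I ?v + C * I (\<lambda>x. g x - s k x)"
    proof (rule dirichlet_sum_le_combination(2))
      fix x y
      have "h y + s k y - (h x + s k x) = (?v y - ?v x) + - ((g y - s k y) - (g x - s k x))" by simp
      then show "\<bar>h y + s k y - (h x + s k x)\<bar> powr p
          \<le> (1 + c) * \<bar>?v y - ?v x\<bar> powr p + C * \<bar>(g y - s k y) - (g x - s k x)\<bar> powr p"
        using C(2)[of "?v y - ?v x" "- ((g y - s k y) - (g x - s k x))"] by (simp only: abs_minus_cancel)
    qed (use c C h s in \<open>auto intro: dirichlet_space_add dirichlet_space_diff\<close>)
    finally show ?thesis .
  qed
  moreover have "(\<lambda>k. (1 + c) * I ?v + C * I (\<lambda>x. g x - s k x)) \<longlonglongrightarrow> (1 + c) * I ?v + C * 0"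
    by (intro tendsto_intros s)
  ultimately have "I h \<le> (1 + c) * I ?v + C * 0" by (intro LIMSEQ_le_const) auto
  moreover have "c * I ?v \<le> e"
    using e I1 dirichlet_sum_nonneg[of ?v] by (simp add: c_def pos_divide_le_eq)
  ultimately show "I h \<le> I ?v + e" by (simp add: distrib_right)
qed

text \<open>Both functions minimise the energy in the convex class \<open>w + C0\<close>, so their difference has zero
  energy.\<close>

theorem p_harmonic_difference_constant:
  assumes h: "h \<in> D" "p_harmonic adj p h" and w: "w \<in> D" "p_harmonic adj p w"
    and hw: "(\<lambda>x. h x - w x) \<in> C0"
  shows "h x - w x = h v0 - w v0"
proof -
  define K where "K = {v \<in> D. (\<lambda>x. v x - w x) \<in> C0}"
  have hK: "h \<in> K" and wK: "w \<in> K"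
    using h w hw finitely_supported_subset_closure by (auto simp: K_def finitely_supported_def)
  have w_min: "I w \<le> I v" if "v \<in> K" for v
    using p_harmonic_minimises[OF w, of "\<lambda>x. v x - w x"] that by (simp add: K_def)
  have h_min: "I h \<le> I w"
    using p_harmonic_minimises[OF h dirichlet_closure_minus[OF hw]] by simp
  have mid: "(\<lambda>x. (f x + g x) / 2) \<in> K" if "f \<in> K" "g \<in> K" for f g
    using that dirichlet_closure_coset_midpoint[of f g w] by (simp add: K_def)
  have KD: "K \<subseteq> D" by (auto simp: K_def)
  have "I (\<lambda>x. h x - w x) \<le> 0 + e" if e: "0 < e" for e
  proof -
    obtain d where d: "0 < d" "\<And>f g. f \<in> K \<Longrightarrow> g \<in> K \<Longrightarrow> I f \<le> I w + d \<Longrightarrow> I g \<le> I w + d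
        \<Longrightarrow> I (\<lambda>x. f x - g x) < e"
      using near_minimisers_are_close[OF KD mid dirichlet_sum_nonneg w_min e] by blast
    from d(2)[OF hK wK] show ?thesis using h_min d(1) by simp
  qed
  then have "I (\<lambda>x. h x - w x) \<le> 0" by (rule field_le_epsilon)
  then have "I (\<lambda>x. h x - w x) = 0" using dirichlet_sum_nonneg by (simp add: order_antisym)
  with constant_if_dirichlet_sum_zero[OF dirichlet_space_diff[OF h(1) w(1)]] show ?thesis by blast
qed

section \<open>The algebra of bounded Dirichlet functions\<close>

lemma bounded_functions_iff: "f \<in> bounded_functions \<longleftrightarrow> (\<exists>M. \<forall>x. \<bar>f x\<bar> \<le> M)"
  by (auto simp: bounded_functions_def bounded_iff)

lemma bounded_dirichlet_iff: "f \<in> BD \<longleftrightarrow> f \<in> D \<and> f \<in> bounded_functions"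
  by (simp add: bounded_dirichlet_def)

lemma bounded_functions_const: "(\<lambda>_. c) \<in> bounded_functions"
  by (auto simp: bounded_functions_iff)

lemma bounded_functions_add:
  assumes "f \<in> bounded_functions" "g \<in> bounded_functions"
  shows "(\<lambda>x. f x + g x) \<in> bounded_functions"
proof -
  obtain M N where "\<And>x. \<bar>f x\<bar> \<le> M" "\<And>x. \<bar>g x\<bar> \<le> N"
    using assms by (auto simp: bounded_functions_iff)
  then have "\<bar>f x + g x\<bar> \<le> M + N" for x by (intro order_trans[OF abs_triangle_ineq] add_mono)
  then show ?thesis by (auto simp: bounded_functions_iff)
qed

lemma bounded_functions_mult:
  assumes "f \<in> bounded_functions" "g \<in> bounded_functions"
  shows "(\<lambda>x. f x * g x) \<in> bounded_functions"
proof -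
  obtain M N where MN: "\<And>x. \<bar>f x\<bar> \<le> M" "\<And>x. \<bar>g x\<bar> \<le> N"
    using assms by (auto simp: bounded_functions_iff)
  then have "0 \<le> M" using abs_ge_zero order_trans by blast
  then have "\<bar>f x * g x\<bar> \<le> M * N" for x
    unfolding abs_mult using MN by (intro mult_mono) auto
  then show ?thesis by (auto simp: bounded_functions_iff)
qed

lemma bounded_functions_cmult: "f \<in> bounded_functions \<Longrightarrow> (\<lambda>x. c * f x) \<in> bounded_functions"
  by (rule bounded_functions_mult[OF bounded_functions_const])

lemma bounded_functions_abs: "f \<in> bounded_functions \<Longrightarrow> (\<lambda>x. \<bar>f x\<bar>) \<in> bounded_functions"
  by (simp add: bounded_functions_iff)

lemma bounded_dirichlet_const: "(\<lambda>_. c) \<in> BD"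
  by (simp add: bounded_dirichlet_iff bounded_functions_const const_in_dirichlet_space)

lemma bounded_dirichlet_add: "f \<in> BD \<Longrightarrow> g \<in> BD \<Longrightarrow> (\<lambda>x. f x + g x) \<in> BD"
  by (simp add: bounded_dirichlet_iff bounded_functions_add dirichlet_space_add)

lemma bounded_dirichlet_cmult: "f \<in> BD \<Longrightarrow> (\<lambda>x. c * f x) \<in> BD"
  by (simp add: bounded_dirichlet_iff bounded_functions_cmult dirichlet_space_cmult)

lemma bounded_dirichlet_mult:
  assumes "f \<in> BD" "g \<in> BD"
  shows "(\<lambda>x. f x * g x) \<in> BD"
proof -
  obtain M N where MN: "\<And>x. \<bar>f x\<bar> \<le> M" "\<And>x. \<bar>g x\<bar> \<le> N"
    using assms by (auto simp: bounded_dirichlet_iff bounded_functions_iff)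
  then have M0: "0 \<le> M" "0 \<le> N" using abs_ge_zero order_trans by blast+
  have "(\<lambda>x. f x * g x) \<in> D"
  proof (rule dirichlet_space_if_increments_le)
    fix x y
    have "f y * g y - f x * g x = g y * (f y - f x) + f x * (g y - g x)" by (simp add: algebra_simps)
    then have "\<bar>f y * g y - f x * g x\<bar> \<le> \<bar>g y\<bar> * \<bar>f y - f x\<bar> + \<bar>f x\<bar> * \<bar>g y - g x\<bar>"
      using abs_triangle_ineq[of "g y * (f y - f x)" "f x * (g y - g x)"] by (simp only: abs_mult)
    also have "\<dots> \<le> N * \<bar>f y - f x\<bar> + M * \<bar>g y - g x\<bar>"
      using MN by (intro add_mono mult_right_mono) auto
    finally show "\<bar>f y * g y - f x * g x\<bar> \<le> N * \<bar>f y - f x\<bar> + M * \<bar>g y - g x\<bar>" .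
  qed (use assms M0 in \<open>auto simp: bounded_dirichlet_iff\<close>)
  then show ?thesis using assms by (simp add: bounded_dirichlet_iff bounded_functions_mult)
qed

text \<open>Inversion is Lipschitz with constant \<open>1 / c\<^sup>2\<close> on \<open>[c, \<infinity>)\<close>.\<close>

lemma bounded_dirichlet_inverse:
  assumes f: "f \<in> BD" and c: "0 < c" "\<And>x. c \<le> f x"
  shows "(\<lambda>x. inverse (f x)) \<in> BD"
proof -
  have pos: "0 < f x" for x using c by (rule less_le_trans)
  have inv: "inverse (f x) \<le> inverse c" for x using c by (intro le_imp_inverse_le)
  have "(\<lambda>x. inverse (f x)) \<in> D"
  proof (rule dirichlet_space_if_increments_le[where g = f and k = f and a = "inverse c * inverse c" and b = 0])
    fix x y
    have nz: "f x \<noteq> 0" "f y \<noteq> 0" using pos[of x] pos[of y] by auto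
    have "inverse (f y) - inverse (f x) = - (inverse (f y) * inverse (f x)) * (f y - f x)"
      using nz by (simp add: field_simps)
    then have "\<bar>inverse (f y) - inverse (f x)\<bar> = (inverse (f y) * inverse (f x)) * \<bar>f y - f x\<bar>"
      using pos[of x] pos[of y] by (simp add: abs_mult)
    also have "\<dots> \<le> (inverse c * inverse c) * \<bar>f y - f x\<bar>"
      using inv pos[of x] pos[of y] c by (intro mult_right_mono mult_mono) (auto intro: less_imp_le)
    finally show "\<bar>inverse (f y) - inverse (f x)\<bar>
        \<le> (inverse c * inverse c) * \<bar>f y - f x\<bar> + 0 * \<bar>f y - f x\<bar>" by simp
  qed (use f c in \<open>auto simp: bounded_dirichlet_iff\<close>)
  moreover have "\<bar>inverse (f x)\<bar> \<le> inverse c" for x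
    using inv[of x] pos[of x] by simp
  then have "(\<lambda>x. inverse (f x)) \<in> bounded_functions" by (auto simp: bounded_functions_iff)
  ultimately show ?thesis by (simp add: bounded_dirichlet_iff)
qed

section \<open>The spectrum\<close>

abbreviation "Sp \<equiv> spectrum adj p"
abbreviation "bdry \<equiv> harmonic_boundary adj p v0"

lemma
  assumes "\<tau> \<in> Sp"
  shows spectrum_add: "f \<in> BD \<Longrightarrow> g \<in> BD \<Longrightarrow> \<tau> (\<lambda>x. f x + g x) = \<tau> f + \<tau> g"
    and spectrum_mult: "f \<in> BD \<Longrightarrow> g \<in> BD \<Longrightarrow> \<tau> (\<lambda>x. f x * g x) = \<tau> f * \<tau> g"
    and spectrum_cmult: "f \<in> BD \<Longrightarrow> \<tau> (\<lambda>x. c * f x) = complex_of_real c * \<tau> f"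
  using assms by (auto simp: spectrum_def)

lemma spectrum_const:
  assumes "\<tau> \<in> Sp"
  shows "\<tau> (\<lambda>_. c) = complex_of_real c"
proof -
  obtain f where f: "f \<in> BD" "\<tau> f \<noteq> 0" using assms by (auto simp: spectrum_def)
  have "\<tau> (\<lambda>x. c * f x) = \<tau> (\<lambda>_. c) * \<tau> f"
    by (rule spectrum_mult[OF assms bounded_dirichlet_const f(1)])
  then show ?thesis using spectrum_cmult[OF assms f(1)] f(2) by simp
qed

text \<open>If \<open>\<tau> f\<close> were \<open>- a + \<i> b\<close> with \<open>b \<noteq> 0\<close>, then \<open>(f + a)\<^sup>2 + b\<^sup>2\<close> would be mapped to 0, although it is
  bounded away from 0 and hence invertible in \<open>BD\<close>.\<close>

lemma spectrum_real:
  assumes \<tau>: "\<tau> \<in> Sp" and f: "f \<in> BD"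
  shows "\<tau> f = complex_of_real (Re (\<tau> f))"
proof (rule ccontr)
  assume "\<not> ?thesis"
  then have b: "Im (\<tau> f) \<noteq> 0" by (auto simp: complex_eq_iff)
  define a where "a = - Re (\<tau> f)"
  let ?g = "\<lambda>x. f x + a" and ?c = "(Im (\<tau> f))\<^sup>2"
  have g: "?g \<in> BD" by (intro bounded_dirichlet_add f bounded_dirichlet_const)
  have gg: "(\<lambda>x. ?g x * ?g x) \<in> BD" by (intro bounded_dirichlet_mult g)
  let ?q = "\<lambda>x. ?g x * ?g x + ?c"
  have q: "?q \<in> BD" by (intro bounded_dirichlet_add gg bounded_dirichlet_const)
  have "\<tau> ?g = \<tau> f + complex_of_real a"
    using spectrum_add[OF \<tau> f bounded_dirichlet_const] spectrum_const[OF \<tau>] by simp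
  then have "\<tau> ?g = \<i> * complex_of_real (Im (\<tau> f))" by (simp add: a_def complex_eq_iff)
  then have "\<tau> (\<lambda>x. ?g x * ?g x) = - complex_of_real ?c"
    using spectrum_mult[OF \<tau> g g] by (simp add: power2_eq_square complex_eq_iff)
  then have q0: "\<tau> ?q = 0"
    using spectrum_add[OF \<tau> gg bounded_dirichlet_const[of ?c]] spectrum_const[OF \<tau>] by simp
  have c: "0 < ?c" "?c \<le> ?q x" for x using b by auto
  have qi: "(\<lambda>x. inverse (?q x)) \<in> BD" by (rule bounded_dirichlet_inverse[OF q c])
  have "?q x * inverse (?q x) = 1" for x using c(1) c(2)[of x] by (intro right_inverse) linarith
  then have "\<tau> (\<lambda>x. 1) = \<tau> ?q * \<tau> (\<lambda>x. inverse (?q x))"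
    using spectrum_mult[OF \<tau> q qi] by (simp only:)
  then show False using q0 spectrum_const[OF \<tau>, of 1] by simp
qed

lemma spectrum_separated:
  assumes "\<sigma> \<in> Sp" "\<tau> \<in> Sp" "\<sigma> \<noteq> \<tau>"
  obtains f where "f \<in> BD" "\<sigma> f = 1" "\<tau> f = 0"
proof -
  have "\<exists>g\<in>BD. \<sigma> g \<noteq> \<tau> g"
  proof (rule ccontr)
    assume "\<not> ?thesis"
    then have "\<sigma> = \<tau>" using assms by (intro extensionalityI[of _ BD]) (auto simp: spectrum_def)
    then show False using assms by simp
  qed
  then obtain g where g: "g \<in> BD" "\<sigma> g \<noteq> \<tau> g" by blast
  define a b where "a = Re (\<sigma> g)" and "b = Re (\<tau> g)"
  have ab: "\<sigma> g = complex_of_real a" "\<tau> g = complex_of_real b"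
    using spectrum_real g assms by (auto simp: a_def b_def)
  then have "a \<noteq> b" using g by auto
  let ?h = "\<lambda>x. g x + - b" and ?f = "\<lambda>x. inverse (a - b) * (g x + - b)"
  have h: "?h \<in> BD" by (intro bounded_dirichlet_add g bounded_dirichlet_const)
  have val: "\<rho> ?f = complex_of_real (inverse (a - b)) * (\<rho> g + complex_of_real (- b))" if "\<rho> \<in> Sp" for \<rho>
    using spectrum_cmult[OF that h] spectrum_add[OF that g(1) bounded_dirichlet_const] spectrum_const[OF that]
    by (simp only:)
  have "\<sigma> ?f = complex_of_real (inverse (a - b) * (a + - b))" "\<tau> ?f = complex_of_real (inverse (a - b) * (b + - b))"
    unfolding val[OF assms(1)] val[OF assms(2)] ab by simp_all
  then have "\<sigma> ?f = 1" "\<tau> ?f = 0" using \<open>a \<noteq> b\<close> by simp_all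
  moreover have "?f \<in> BD" by (intro bounded_dirichlet_cmult h)
  ultimately show ?thesis using that by blast
qed

lemma spectrum_peak:
  assumes "finite T" "T \<subseteq> Sp" "\<sigma> \<in> Sp" "\<sigma> \<notin> T"
  shows "\<exists>f\<in>BD. \<sigma> f = 1 \<and> (\<forall>\<tau>\<in>T. \<tau> f = 0)"
  using assms
proof (induction T)
  case empty
  then show ?case using bounded_dirichlet_const[of 1] spectrum_const[of \<sigma> 1] by auto
next
  case (insert \<rho> T)
  then obtain f where f: "f \<in> BD" "\<sigma> f = 1" "\<forall>\<tau>\<in>T. \<tau> f = 0" by auto
  obtain g where g: "g \<in> BD" "\<sigma> g = 1" "\<rho> g = 0"
    using spectrum_separated[of \<sigma> \<rho>] insert.prems by auto
  have "\<tau> (\<lambda>x. f x * g x) = \<tau> f * \<tau> g" if "\<tau> \<in> Sp" for \<tau>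
    using that f g by (intro spectrum_mult)
  then have "\<sigma> (\<lambda>x. f x * g x) = 1" "\<forall>\<tau>\<in>insert \<rho> T. \<tau> (\<lambda>x. f x * g x) = 0"
    using f g insert.prems by (metis mult_1, metis insert_iff mult_zero_left mult_zero_right subsetD)
  then show ?case using bounded_dirichlet_mult[OF f(1) g(1)] by blast
qed

lemma spectrum_interpolation:
  fixes a :: "(('v \<Rightarrow> real) \<Rightarrow> complex) \<Rightarrow> real"
  assumes "finite T" "T \<subseteq> Sp"
  shows "\<exists>f\<in>BD. \<forall>\<tau>\<in>T. \<tau> f = complex_of_real (a \<tau>)"
  using assms
proof (induction T)
  case empty
  then show ?case using bounded_dirichlet_const by auto
next
  case (insert \<sigma> T)
  then obtain f where f: "f \<in> BD" "\<forall>\<tau>\<in>T. \<tau> f = complex_of_real (a \<tau>)" by auto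
  obtain e where e: "e \<in> BD" "\<sigma> e = 1" "\<forall>\<tau>\<in>T. \<tau> e = 0"
    using spectrum_peak[of T \<sigma>] insert by auto
  define c where "c = a \<sigma> - Re (\<sigma> f)"
  have ce: "(\<lambda>x. c * e x) \<in> BD" by (intro bounded_dirichlet_cmult e)
  have val: "\<tau> (\<lambda>x. f x + c * e x) = \<tau> f + complex_of_real c * \<tau> e" if "\<tau> \<in> Sp" for \<tau>
    using spectrum_add[OF that f(1) ce] spectrum_cmult[OF that e(1)] by simp
  have "\<sigma> f = complex_of_real (Re (\<sigma> f))" using insert.prems f by (intro spectrum_real) auto
  then have "\<sigma> f + complex_of_real c = complex_of_real (a \<sigma>)"
    unfolding c_def by (metis add_diff_cancel_left' add_diff_eq of_real_add of_real_diff)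
  then have "\<sigma> (\<lambda>x. f x + c * e x) = complex_of_real (a \<sigma>)"
    using val[of \<sigma>] e insert.prems by simp
  moreover have "\<tau> (\<lambda>x. f x + c * e x) = complex_of_real (a \<tau>)" if "\<tau> \<in> T" for \<tau>
    using val[of \<tau>] f e insert.prems that by auto
  ultimately show ?case using bounded_dirichlet_add[OF f(1) ce] by blast
qed

lemma point_eval_in_spectrum: "point_eval adj p v \<in> Sp"
  using bounded_dirichlet_const[of 1]
  by (auto simp: spectrum_def point_eval_def bounded_dirichlet_add bounded_dirichlet_mult
      bounded_dirichlet_cmult intro!: bexI[of _ "\<lambda>_. 1"])

lemma limitin_spectrum_iff:
  "limitin (spectrum_topology adj p) (point_eval adj p) \<tau> F \<longleftrightarrow>
     \<tau> \<in> Sp \<and> (\<forall>f\<in>BD. ((\<lambda>v. complex_of_real (f v)) \<longlongrightarrow> \<tau> f) F)"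
proof -
  have "\<tau> \<in> extensional BD" if "\<tau> \<in> Sp" using that by (simp add: spectrum_def)
  moreover have "point_eval adj p v \<in> extensional BD" for v by (simp add: point_eval_def)
  moreover have "((\<lambda>v. point_eval adj p v f) \<longlongrightarrow> \<tau> f) F \<longleftrightarrow> ((\<lambda>v. complex_of_real (f v)) \<longlongrightarrow> \<tau> f) F"
    if "f \<in> BD" for f using that by (simp add: point_eval_def)
  ultimately show ?thesis
    by (auto simp: spectrum_topology_def limitin_subtopology limitin_componentwise point_eval_in_spectrum
        PiE_def)
qed

lemma bounded_dirichlet_has_boundary_value:
  assumes "f \<in> BD" "\<tau> f = complex_of_real a"
  shows "has_boundary_value adj p f \<tau> a"
  unfolding has_boundary_value_def limitin_spectrum_iff
  using assms by (metis tendsto_of_real_iff)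

text \<open>Compactness of the spectrum, in the form needed here: every filter on \<open>V\<close> has a refinement along
  which all functions in \<open>BD\<close> converge. This is Tychonoff's theorem for the product of the ranges.\<close>

lemma filter_refinement_converging_on_bounded_dirichlet:
  assumes F: "(F :: 'v filter) \<noteq> bot"
  obtains G T where "G \<le> F" "G \<noteq> bot" "\<And>f. f \<in> BD \<Longrightarrow> (f \<longlongrightarrow> T f) G"
proof -
  have "\<forall>f\<in>BD. \<exists>M. \<forall>x. \<bar>f x\<bar> \<le> M" by (auto simp: bounded_dirichlet_iff bounded_functions_iff)
  then obtain M where M: "\<And>f x. f \<in> BD \<Longrightarrow> \<bar>f x\<bar> \<le> M f" by metis
  \<comment> \<open>Functions outside \<open>BD\<close> have no bound; their coordinates are set to 0, and 0 is added to every
      interval of \<open>U\<close> because \<open>M\<close> is arbitrary there.\<close>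
  define ev where "ev v f = (if f \<in> BD then f v else 0)" for v and f :: "'v \<Rightarrow> real"
  define U where "U = (\<Pi>\<^sub>E f\<in>UNIV. {- M f..M f} \<union> {0::real})"
  have "compactin (product_topology (\<lambda>_. euclidean) UNIV) U"
    unfolding U_def compactin_PiE by (auto intro: compact_Un)
  then have U: "compact U" by (simp add: euclidean_product_topology)
  have "ev v \<in> U" for v using M by (auto simp: U_def ev_def abs_le_iff minus_le_iff)
  then have evU: "\<forall>\<^sub>F x in filtermap ev F. x \<in> U" by (simp add: eventually_filtermap)
  obtain T where T: "inf (nhds T) (filtermap ev F) \<noteq> bot"
    using U[unfolded compact_filter] evU F by (metis filtermap_bot_iff)
  define G where "G = inf (filtercomap ev (nhds T)) F"
  have "G \<noteq> bot"
  proof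
    assume "G = bot"
    then have "\<forall>\<^sub>F v in G. False" by simp
    then obtain P Q where P: "eventually P (filtercomap ev (nhds T))" and Q: "eventually Q F"
      and PQ: "\<And>v. P v \<Longrightarrow> Q v \<Longrightarrow> False"
      unfolding G_def eventually_inf by blast
    obtain P' where P': "eventually P' (nhds T)" "\<And>v. P' (ev v) \<Longrightarrow> P v"
      using P unfolding eventually_filtercomap by blast
    have "eventually (\<lambda>y. \<not> P' y) (filtermap ev F)"
      unfolding eventually_filtermap using Q by eventually_elim (use PQ P' in blast)
    then have "\<forall>\<^sub>F y in inf (nhds T) (filtermap ev F). False"
      unfolding eventually_inf using P'(1) by blast
    then show False using T by (simp add: eventually_False)
  qed
  moreover have "(f \<longlongrightarrow> T f) G" if "f \<in> BD" for f
  proof -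
    have "filterlim ev (nhds T) G"
      unfolding G_def by (meson filterlim_filtercomap filterlim_mono inf_le1 order_refl)
    moreover have "((\<lambda>y. y f) \<longlongrightarrow> T f) (nhds T)"
      unfolding tendsto_def
    proof (intro allI impI)
      fix S :: "real set" assume S: "open S" "T f \<in> S"
      have "open ((\<lambda>y. y f) -` S)"
        using S(1) continuous_on_product_coordinates by (rule open_vimage)
      then show "\<forall>\<^sub>F y in nhds T. y f \<in> S"
        using S(2) eventually_nhds_in_open[of "(\<lambda>y. y f) -` S" T] by simp
    qed
    ultimately have "((\<lambda>v. ev v f) \<longlongrightarrow> T f) G"
      by (rule filterlim_compose[rotated])
    then show ?thesis using that by (simp add: ev_def)
  qed
  moreover have "G \<le> F" by (simp add: G_def)
  ultimately show ?thesis using that by blast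
qed

section \<open>Boundary values\<close>

text \<open>If no \<open>g\<close> worked, the sets \<open>{h - f > e} \<inter> {\<bar>g\<bar> < 1}\<close> would generate a proper filter, because
  \<open>\<bar>g\<bar> + \<bar>k\<bar>\<close> again lies in \<open>C0\<close>. A refinement along which all of \<open>BD\<close> converges defines a
  homomorphism \<open>\<tau>\<close>. Multiples of \<open>g\<close> are also admissible, so \<open>\<tau> g = 0\<close> for all \<open>g\<close>, and \<open>\<tau>\<close> is a point
  of the harmonic boundary. There \<open>h - f\<close> tends to 0, in contradiction to \<open>h - f > e\<close>.\<close>

lemma excess_set_dominated_by_closure:
  assumes h: "\<And>\<tau>. \<tau> \<in> bdry \<Longrightarrow> has_boundary_value adj p h \<tau> (Re (\<tau> f))"
    and f: "f \<in> BD" and e: "0 < e"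
  shows "\<exists>g\<in>C0 \<inter> bounded_functions. \<forall>v. e < h v - f v \<longrightarrow> 1 \<le> \<bar>g v\<bar>"
proof (rule ccontr)
  assume neg: "\<not> ?thesis"
  define B where "B = C0 \<inter> bounded_functions"
  define A where "A g = {v. e < h v - f v \<and> \<bar>g v\<bar> < 1}" for g :: "'v \<Rightarrow> real"
  have A: "A g \<noteq> {}" if "g \<in> B" for g using neg that by (force simp: A_def B_def)
  have BD: "g \<in> BD" if "g \<in> B" for g
    using that by (auto simp: B_def bounded_dirichlet_iff dirichlet_closure_def)
  have fin_B: "s \<in> B" if "s \<in> finitely_supported" for s
  proof -
    have "range s \<subseteq> insert 0 (s ` {x. s x \<noteq> 0})" by auto
    then have "finite (range s)" using that by (rule_tac finite_subset) (auto simp: finitely_supported_def)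
    then show ?thesis using that finitely_supported_subset_closure finite_imp_bounded
      by (auto simp: B_def bounded_functions_def)
  qed
  define F where "F = (INF g\<in>B. principal (A g))"
  have "F \<noteq> bot"
  proof
    assume "F = bot"
    then have "\<forall>\<^sub>F v in F. False" by simp
    moreover have "\<exists>k\<in>B. principal (A k) \<le> inf (principal (A g)) (principal (A h))"
      if "g \<in> B" "h \<in> B" for g h
    proof (intro bexI[of _ "\<lambda>x. \<bar>g x\<bar> + \<bar>h x\<bar>"])
      show "(\<lambda>x. \<bar>g x\<bar> + \<bar>h x\<bar>) \<in> B"
        using that unfolding B_def
        by (intro IntI dirichlet_closure_add dirichlet_closure_abs bounded_functions_add bounded_functions_abs) auto
      show "principal (A (\<lambda>x. \<bar>g x\<bar> + \<bar>h x\<bar>)) \<le> inf (principal (A g)) (principal (A h))"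
        by (auto simp: A_def)
    qed
    moreover have "B \<noteq> {}" using fin_B[of "\<lambda>_. 0"] by (auto simp: finitely_supported_def)
    ultimately obtain g where "g \<in> B" "\<forall>\<^sub>F v in principal (A g). False"
      unfolding F_def by (subst (asm) eventually_INF_base) auto
    then show False using A by (auto simp: eventually_principal)
  qed
  then obtain G T where GF: "G \<le> F" and G: "G \<noteq> bot" and T: "\<And>f. f \<in> BD \<Longrightarrow> (f \<longlongrightarrow> T f) G"
    using filter_refinement_converging_on_bounded_dirichlet by metis
  have evA: "\<forall>\<^sub>F v in G. v \<in> A g" if "g \<in> B" for g
    by (rule filter_leD[OF GF]) (use that in \<open>auto simp: F_def eventually_principal intro: eventually_INF1\<close>)
  have T_eq: "T f = c" if "f \<in> BD" "(f \<longlongrightarrow> c) G" for f c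
    using tendsto_unique[OF G T[OF that(1)] that(2)] .
  have T0: "T g = 0" if g: "g \<in> B" for g
  proof (rule T_eq[OF BD[OF g]])
    show "(g \<longlongrightarrow> 0) G"
      unfolding tendsto_iff
    proof (intro allI impI)
      fix r :: real assume r: "0 < r"
      have "(\<lambda>x. inverse r * g x) \<in> B"
        using g by (auto simp: B_def intro: dirichlet_closure_cmult bounded_functions_cmult)
      from evA[OF this] show "\<forall>\<^sub>F x in G. dist (g x) 0 < r"
        by eventually_elim (use r in \<open>auto simp: A_def abs_mult field_simps\<close>)
    qed
  qed
  define \<tau> where "\<tau> = restrict (\<lambda>f. complex_of_real (T f)) BD"
  have "\<tau> \<in> Sp"
  proof -
    have "T (\<lambda>x. k x + g x) = T k + T g \<and> T (\<lambda>x. k x * g x) = T k * T g"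
      if "k \<in> BD" "g \<in> BD" for k g
      using that by (intro conjI T_eq bounded_dirichlet_add bounded_dirichlet_mult tendsto_add tendsto_mult T)
    moreover have "T (\<lambda>x. c * k x) = c * T k" if "k \<in> BD" for c k
      using that by (intro T_eq bounded_dirichlet_cmult tendsto_mult tendsto_const T)
    moreover have "T (\<lambda>_. 1) = 1" by (intro T_eq bounded_dirichlet_const tendsto_const)
    ultimately show ?thesis
      by (auto simp: spectrum_def \<tau>_def bounded_dirichlet_add bounded_dirichlet_mult
        bounded_dirichlet_cmult bounded_dirichlet_const intro!: bexI[of _ "\<lambda>_. 1"])
  qed
  \<comment> \<open>indicators of single vertices lie in \<open>C0\<close>, so \<open>\<tau>\<close> kills them, unlike evaluation at the vertex\<close>
  have "\<tau> \<notin> range (point_eval adj p)"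
  proof
    assume "\<tau> \<in> range (point_eval adj p)"
    then obtain v where v: "\<tau> = point_eval adj p v" by auto
    let ?s = "\<lambda>y. if y = v then 1 else 0 :: real"
    have s: "?s \<in> B" by (rule fin_B) (simp add: finitely_supported_def)
    have "\<tau> ?s = 0" using T0[OF s] BD[OF s] by (simp add: \<tau>_def)
    moreover have "\<tau> ?s = 1" unfolding v using BD[OF s] by (simp add: point_eval_def)
    ultimately show False by simp
  qed
  then have "\<tau> \<in> bdry"
    using \<open>\<tau> \<in> Sp\<close> T0 BD by (auto simp: harmonic_boundary_def royden_boundary_def B_def \<tau>_def)
  moreover have "limitin (spectrum_topology adj p) (point_eval adj p) \<tau> G"
    unfolding limitin_spectrum_iff using \<open>\<tau> \<in> Sp\<close> by (auto simp: \<tau>_def intro!: tendsto_of_real T)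
  ultimately have "(h \<longlongrightarrow> Re (\<tau> f)) G" using h by (auto simp: has_boundary_value_def)
  from tendsto_diff[OF this T[OF f]] have "((\<lambda>v. h v - f v) \<longlongrightarrow> 0) G"
    using f by (simp add: \<tau>_def)
  moreover have "(\<lambda>_. 0) \<in> B" using fin_B[of "\<lambda>_. 0"] by (auto simp: finitely_supported_def)
  from evA[OF this] have "\<forall>\<^sub>F v in G. e \<le> h v - f v" by eventually_elim (simp add: A_def)
  ultimately have "e \<le> 0" using G by (intro tendsto_lowerbound)
  then show False using e by simp
qed

text \<open>\<open>h\<close> may have infinite energy, but it lies below a function in \<open>f + C0\<close> up to \<open>e\<close> and can serve
  as a lower obstacle.\<close>

lemma p_harmonic_majorant:
  assumes h: "h \<in> bounded_functions" "p_harmonic adj p h"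
    and b: "\<And>\<tau>. \<tau> \<in> bdry \<Longrightarrow> has_boundary_value adj p h \<tau> (Re (\<tau> f))"
    and f: "f \<in> BD" and e: "0 < e"
  obtains w where "w \<in> D" "p_harmonic adj p w" "(\<lambda>x. w x - f x) \<in> C0" "\<And>x. h x \<le> w x + e"
proof -
  obtain g where g: "g \<in> C0" "g \<in> bounded_functions" "\<And>v. e < h v - f v \<Longrightarrow> 1 \<le> \<bar>g v\<bar>"
    using excess_set_dominated_by_closure[OF b f e] by auto
  obtain M1 M2 where M: "\<And>x. \<bar>h x\<bar> \<le> M1" "\<And>x. \<bar>f x\<bar> \<le> M2"
    using h f by (auto simp: bounded_dirichlet_iff bounded_functions_iff)
  define M where "M = M1 + M2"
  let ?k = "\<lambda>x. M * \<bar>g x\<bar>" and ?F = "\<lambda>x. f x + M * \<bar>g x\<bar>"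
  have M0: "0 \<le> M" using M[of undefined] by (simp add: M_def)
  have k: "?k \<in> C0"
    by (intro dirichlet_closure_cmult dirichlet_closure_abs g)
  then have "?k \<in> D" by (simp add: dirichlet_closure_def)
  then have FD: "?F \<in> D" using f by (intro dirichlet_space_add) (simp_all add: bounded_dirichlet_iff)
  have "?F \<in> bounded_functions"
    using f g by (intro bounded_functions_add bounded_functions_cmult bounded_functions_abs)
      (simp_all add: bounded_dirichlet_iff)
  then obtain c where c: "\<And>x. \<bar>?F x\<bar> \<le> c" by (auto simp: bounded_functions_iff)
  have hF: "h x - e \<le> ?F x" for x
  proof (cases "e < h x - f x")
    case True
    have "M * 1 \<le> ?k x" using g(3)[OF True] M0 by (intro mult_left_mono)
    moreover have "h x \<le> M1" "- f x \<le> M2" using M[of x] by auto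
    ultimately show ?thesis using e by (simp add: M_def)
  next
    case False
    moreover have "0 \<le> ?k x" using M0 by simp
    ultimately show ?thesis by linarith
  qed
  have "L (\<lambda>x. h x - e) x = L h x" for x by (simp add: p_laplacian_def)
  then have l: "0 \<le> L (\<lambda>x. h x - e) x" for x using h by (simp add: p_harmonic_def)
  have u: "L (\<lambda>_. c) x \<le> 0" for x by (simp add: p_laplacian_const)
  have Fc: "?F x \<le> c" for x using c[of x] by linarith
  obtain w where w: "w \<in> D" "p_harmonic adj p w" "(\<lambda>x. w x - ?F x) \<in> C0" "\<And>x. h x - e \<le> w x"
    using p_harmonic_between_obstacles[where f = ?F, OF FD hF Fc l u] by blast
  have "(\<lambda>x. (w x - ?F x) + ?k x) \<in> C0" by (rule dirichlet_closure_add[OF w(3) k])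
  then have "(\<lambda>x. w x - f x) \<in> C0" by simp
  moreover have "h x \<le> w x + e" for x using w(4)[of x] by linarith
  ultimately show ?thesis using that w by blast
qed

text \<open>A point of the harmonic boundary sends the constant \<open>h - w \<in> C0\<close> both to 0 and to its value.\<close>

lemma p_harmonic_unique_in_class:
  assumes "bdry \<noteq> {}"
    and h: "h \<in> D" "p_harmonic adj p h" and w: "w \<in> D" "p_harmonic adj p w"
    and hw: "(\<lambda>x. h x - w x) \<in> C0"
  shows "h = w"
proof -
  define c where "c = h v0 - w v0"
  have c: "h x - w x = c" for x unfolding c_def by (rule p_harmonic_difference_constant[OF h w hw])
  obtain \<tau> where \<tau>: "\<tau> \<in> bdry" using assms by blast
  have "(\<lambda>_. c) \<in> C0 \<inter> bounded_functions" using hw by (simp add: c bounded_functions_const)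
  then have "\<tau> (\<lambda>_. c) = 0" using \<tau> by (auto simp: harmonic_boundary_def)
  moreover have "\<tau> \<in> Sp" using \<tau> by (auto simp: harmonic_boundary_def royden_boundary_def)
  ultimately have "c = 0" using spectrum_const[of \<tau> c] by simp
  then show ?thesis using c by (auto simp: fun_eq_iff)
qed

lemma has_boundary_value_minus:
  "has_boundary_value adj p h \<tau> a \<Longrightarrow> has_boundary_value adj p (\<lambda>x. - h x) \<tau> (- a)"
  by (auto simp: has_boundary_value_def intro: tendsto_minus)

text \<open>The finite-energy p-harmonic majorant of \<open>h1\<close> and the p-harmonic minorant of \<open>h2\<close> (from the
  majorant of \<open>- h2\<close>) lie in the same class \<open>f + C0\<close>, so they coincide.\<close>

theorem p_harmonic_le_if_same_boundary_values:
  assumes ne: "bdry \<noteq> {}" and f: "f \<in> BD"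
    and h1: "h1 \<in> bounded_functions" "p_harmonic adj p h1"
      "\<And>\<tau>. \<tau> \<in> bdry \<Longrightarrow> has_boundary_value adj p h1 \<tau> (Re (\<tau> f))"
    and h2: "h2 \<in> bounded_functions" "p_harmonic adj p h2"
      "\<And>\<tau>. \<tau> \<in> bdry \<Longrightarrow> has_boundary_value adj p h2 \<tau> (Re (\<tau> f))"
  shows "h1 x \<le> h2 x"
proof (rule field_le_epsilon)
  fix d :: real assume "0 < d"
  then have e: "0 < d / 2" by simp
  have mh2: "(\<lambda>x. - h2 x) \<in> bounded_functions" "p_harmonic adj p (\<lambda>x. - h2 x)"
    using h2 by (auto simp: bounded_functions_iff p_harmonic_def p_laplacian_minus)
  have mf: "(\<lambda>x. - f x) \<in> BD" using bounded_dirichlet_cmult[OF f, of "-1"] by simp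
  have mb: "has_boundary_value adj p (\<lambda>x. - h2 x) \<tau> (Re (\<tau> (\<lambda>x. - f x)))" if "\<tau> \<in> bdry" for \<tau>
  proof -
    have "\<tau> \<in> Sp" using that by (auto simp: harmonic_boundary_def royden_boundary_def)
    from spectrum_cmult[OF this f, of "-1"] have "Re (\<tau> (\<lambda>x. - f x)) = - Re (\<tau> f)" by simp
    then show ?thesis using has_boundary_value_minus[OF h2(3)[OF that]] by simp
  qed
  obtain u where u: "u \<in> D" "p_harmonic adj p u" "(\<lambda>x. u x - f x) \<in> C0" "\<And>x. h1 x \<le> u x + d / 2"
    using p_harmonic_majorant[OF h1 f e] by blast
  obtain v where v: "v \<in> D" "p_harmonic adj p v" "(\<lambda>x. v x - - f x) \<in> C0" "\<And>x. - h2 x \<le> v x + d / 2"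
    using p_harmonic_majorant[OF mh2 mb mf e] by blast
  have "u = (\<lambda>x. - v x)"
  proof (rule p_harmonic_unique_in_class[OF ne u(1,2)])
    show "(\<lambda>x. - v x) \<in> D" by (rule dirichlet_space_minus[OF v(1)])
    show "p_harmonic adj p (\<lambda>x. - v x)" using v(2) by (simp add: p_harmonic_def p_laplacian_minus)
    have "(\<lambda>x. (u x - f x) + (v x - - f x)) \<in> C0" by (rule dirichlet_closure_add[OF u(3) v(3)])
    then show "(\<lambda>x. u x - - v x) \<in> C0" by simp
  qed
  then show "h1 x \<le> h2 x + d" using u(4)[of x] v(4)[of x] by simp
qed

text \<open>Constants bounding \<open>f\<close> serve as obstacles and keep the solution bounded; it differs from \<open>f\<close>
  by a bounded element of \<open>C0\<close>, on which the harmonic boundary vanishes.\<close>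

theorem dirichlet_problem_solvable:
  assumes f: "f \<in> BD"
  obtains h where "h \<in> bounded_functions" "p_harmonic adj p h"
    "\<And>\<tau>. \<tau> \<in> bdry \<Longrightarrow> has_boundary_value adj p h \<tau> (Re (\<tau> f))"
proof -
  obtain M where M: "\<And>x. \<bar>f x\<bar> \<le> M" using f by (auto simp: bounded_dirichlet_iff bounded_functions_iff)
  have fD: "f \<in> D" using f by (simp add: bounded_dirichlet_iff)
  have lo: "- M \<le> f x" and up: "f x \<le> M" for x using M[of x] by auto
  have lap: "0 \<le> L (\<lambda>_. - M) x" "L (\<lambda>_. M) x \<le> 0" for x by (simp_all add: p_laplacian_const)
  obtain h where h: "h \<in> D" "p_harmonic adj p h" "(\<lambda>x. h x - f x) \<in> C0"
    and hM: "\<And>x. - M \<le> h x" "\<And>x. h x \<le> M"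
    using p_harmonic_between_obstacles[where f = f, OF fD lo up lap] by blast
  have "\<bar>h x\<bar> \<le> M" for x using hM[of x] by (simp add: abs_le_iff minus_le_iff)
  then have hb: "h \<in> bounded_functions" by (auto simp: bounded_functions_iff)
  then have hBD: "h \<in> BD" using h by (simp add: bounded_dirichlet_iff)
  have mf: "(\<lambda>x. -1 * f x) \<in> BD" by (rule bounded_dirichlet_cmult[OF f])
  have "has_boundary_value adj p h \<tau> (Re (\<tau> f))" if \<tau>: "\<tau> \<in> bdry" for \<tau>
  proof (rule bounded_dirichlet_has_boundary_value[OF hBD])
    have S: "\<tau> \<in> Sp" using \<tau> by (auto simp: harmonic_boundary_def royden_boundary_def)
    have "(\<lambda>x. h x + -1 * f x) \<in> C0 \<inter> bounded_functions"
      using h(3) bounded_functions_add[OF hb, of "\<lambda>x. -1 * f x"] mf by (simp add: bounded_dirichlet_iff)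
    then have "\<tau> (\<lambda>x. h x + -1 * f x) = 0" using \<tau> unfolding harmonic_boundary_def by blast
    moreover have "\<tau> (\<lambda>x. h x + -1 * f x) = \<tau> h + complex_of_real (-1) * \<tau> f"
      using spectrum_add[OF S hBD mf] spectrum_cmult[OF S f, of "-1"] by (simp only:)
    ultimately have "\<tau> h = \<tau> f" by simp
    then show "\<tau> h = complex_of_real (Re (\<tau> f))" using spectrum_real[OF S f] by simp
  qed
  then show ?thesis using that h hb by blast
qed

end

theorem corollary2p7:
  fixes adj :: "'v \<Rightarrow> 'v \<Rightarrow> bool"
    and v0 :: 'v
    and p :: real
    and n :: nat
    and x :: "nat \<Rightarrow> ('v \<Rightarrow> real) \<Rightarrow> complex"
  assumes p: "1 < p"
    and countably_infinite: "countable (UNIV :: 'v set)" "infinite (UNIV :: 'v set)"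
    and undirected: "symp adj"
    and no_loops: "irreflp adj"
    and connected: "connected_graph adj"
    and degree: "bounded_degree adj"
    and n: "1 \<le> n"
    and boundary: "bij_betw x {1..n} (harmonic_boundary adj p v0)"
  shows "(\<forall>a :: nat \<Rightarrow> real. \<exists>h. h \<in> bounded_functions \<and> p_harmonic adj p h \<and>
            (\<forall>i\<in>{1..n}. has_boundary_value adj p h (x i) (a i))) \<and>
         (\<forall>(a :: nat \<Rightarrow> real) h1 h2.
            h1 \<in> bounded_functions \<and> p_harmonic adj p h1 \<and>
            (\<forall>i\<in>{1..n}. has_boundary_value adj p h1 (x i) (a i)) \<and>
            h2 \<in> bounded_functions \<and> p_harmonic adj p h2 \<and>
            (\<forall>i\<in>{1..n}. has_boundary_value adj p h2 (x i) (a i)) \<longrightarrow> h1 = h2)"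
proof -
  interpret dirichlet_graph adj p v0
    using p undirected no_loops connected degree
    by unfold_locales (auto simp: connected_graph_def bounded_degree_def dest: sympD irreflpD)
  have bdry: "bdry = x ` {1..n}" using boundary by (simp add: bij_betw_def)
  then have ne: "bdry \<noteq> {}" using n by simp
  have inj: "inj_on x {1..n}" using boundary by (simp add: bij_betw_def)
  have interp: "\<exists>f\<in>BD. \<forall>i\<in>{1..n}. Re (x i f) = a i" for a :: "nat \<Rightarrow> real"
  proof -
    have "\<exists>f\<in>BD. \<forall>\<tau>\<in>x ` {1..n}. \<tau> f = complex_of_real (a (the_inv_into {1..n} x \<tau>))"
    proof (rule spectrum_interpolation)
      show "x ` {1..n} \<subseteq> Sp"
        unfolding bdry[symmetric] by (auto simp: harmonic_boundary_def royden_boundary_def)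
    qed simp
    then obtain f where "f \<in> BD"
      and f: "\<forall>\<tau>\<in>x ` {1..n}. \<tau> f = complex_of_real (a (the_inv_into {1..n} x \<tau>))" by (rule bexE)
    moreover have "Re (x i f) = a i" if "i \<in> {1..n}" for i
      using bspec[OF f, of "x i"] that the_inv_into_f_f[OF inj that] by simp
    ultimately show ?thesis by (intro bexI[of _ f] ballI)
  qed
  show ?thesis
  proof (intro conjI allI impI)
    fix a :: "nat \<Rightarrow> real"
    obtain f where f: "f \<in> BD" "\<forall>i\<in>{1..n}. Re (x i f) = a i" using interp by blast
    obtain h where "h \<in> bounded_functions" "p_harmonic adj p h"
      "\<And>\<tau>. \<tau> \<in> bdry \<Longrightarrow> has_boundary_value adj p h \<tau> (Re (\<tau> f))"
      using dirichlet_problem_solvable[OF f(1)] by blast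
    then show "\<exists>h. h \<in> bounded_functions \<and> p_harmonic adj p h \<and>
            (\<forall>i\<in>{1..n}. has_boundary_value adj p h (x i) (a i))"
      using f(2) unfolding bdry by (intro exI[of _ h]) (metis imageI)
  next
    fix a :: "nat \<Rightarrow> real" and h1 h2 :: "'v \<Rightarrow> real"
    assume H: "h1 \<in> bounded_functions \<and> p_harmonic adj p h1 \<and>
            (\<forall>i\<in>{1..n}. has_boundary_value adj p h1 (x i) (a i)) \<and>
            h2 \<in> bounded_functions \<and> p_harmonic adj p h2 \<and>
            (\<forall>i\<in>{1..n}. has_boundary_value adj p h2 (x i) (a i))"
    obtain f where f: "f \<in> BD" "\<forall>i\<in>{1..n}. Re (x i f) = a i" using interp by blast
    have b: "has_boundary_value adj p h1 \<tau> (Re (\<tau> f))" "has_boundary_value adj p h2 \<tau> (Re (\<tau> f))"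
      if "\<tau> \<in> bdry" for \<tau>
      using that H f(2) unfolding bdry by auto
    have "h1 y \<le> h2 y" "h2 y \<le> h1 y" for y
      using H b by (auto intro!: p_harmonic_le_if_same_boundary_values[OF ne f(1)])
    then show "h1 = h2" by (auto simp: fun_eq_iff intro: order_antisym)
  qed
qed

end
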